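(* Let $\mathcal{E}=\{\rho_x\}_{x=1}^{d^2}$ be any $d$-dimensional SIC ensemble and $\mathcal{P}=\{\Pi_x\}_{x=1}^{d^2}$ any $d$-dimensional SIC POVM, for any dimension $d$. The pretty-good POVM for $\mathcal{E}$ is $\{d\rho_x\}$, the pretty-good ensemble for $\mathcal{P}$ is $\{d^{-1}\Pi_x\}$, and the mutual information given by the pretty-good strategy satisfies $$I(\{\rho_x\},\{d\rho_x\})=I(\{d^{-1}\Pi_x\},\{\Pi_x\})=\frac{2d}{d^2(d+1)}\log d-\frac{d-1}{d^2(d+1)}\log(d+1)\;\le\;\log d-\frac1{\ln 2}\sum_{n=2}^d\frac1n .$$ Thus the lower bounds $A(\mathcal{E})\ge\log d-\frac1{\ln 2}\sum_{n=2}^d\frac1n$ on the accessible information and $W(\mathcal{P})\ge\log d-\frac1{\ln 2}\sum_{n=2}^d\frac1n$ on the informational power are tighter than those provided by the pretty-good POVM and the pretty-good ensemble. Moreover, the value $\log d-\frac1{\ln 2}\sum_{n=2}^d\frac1n$ of the mutual information is achieved on $\mathcal{E}$ by the Scrooge POVM $\mathcal{P}^*$, and on $\mathcal{P}$ by the Scrooge ensemble $\mathcal{E}^*$: $$I(\mathcal{E},\mathcal{P}^* )=I(\mathcal{E}^*,\mathcal{P})=\log d-\frac1{\ln 2}\sum_{n=2}^d\frac1n .$$ Therefore, when extracting information from a SIC ensemble or by a SIC POVM, the strategy based on the Scrooge construction performs strictly better than the pretty-good one.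
   Context: $\log$ is the base-2 logarithm, $\ln$ the natural logarithm. All Hilbert spaces are finite-dimensional and complex. An ensemble is a family $\{\rho_x\}$ of positive semidefinite operators (indexed discretely, or measurably by a continuous real parameter) with $\sum_x\operatorname{Tr}\rho_x=1$ (resp. $\int dx\operatorname{Tr}\rho_x=1$); its average state is $\rho=\sum_x\rho_x$ (resp. $\int dx\,\rho_x$). A POVM is a family $\{\Pi_y\}$ of positive semidefinite operators with $\sum_y\Pi_y=\mathbb{1}$ (resp. $\int dy\,\Pi_y=\mathbb{1}$). Given an ensemble $\mathcal{E}=\{\rho_x\}$ and a POVM $\mathcal{P}=\{\Pi_y\}$, let $p(x,y)=\operatorname{Tr}[\rho_x\Pi_y]$, with marginals $p(x)=\operatorname{Tr}[\rho_x]$, $p(y)=\operatorname{Tr}[\rho\Pi_y]$; the mutual information is $I(\mathcal{E},\mathcal{P})=\sum_{x,y}p(x,y)\log\frac{p(x,y)}{p(x)p(y)}$, sums being replaced by integrals for continuous indices (terms with $p(x,y)=0$ count as $0$). The accessible information of an ensemble $\mathcal{E}$ is $A(\mathcal{E})=\sup_{\mathcal{P}}I(\mathcal{E},\mathcal{P})$ over all discrete or continuous POVMs; the informational power of a POVM $\mathcal{P}$ is $W(\mathcal{P})=\sup_{\mathcal{E}}I(\mathcal{E},\mathcal{P})$ over all discrete or continuous ensembles. The pretty-good POVM for an ensemble $\{\rho_x\}$ with invertible average state $\rho$ is $\{\rho^{-1/2}\rho_x\rho^{-1/2}\}$. The pretty-good ensemble for a POVM $\{\Pi_y\}$ and a normalized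 state $\rho$ is $\{\rho^{1/2}\Pi_y\rho^{1/2}\}$; here, for a SIC POVM, $\rho=\frac1d\mathbb{1}$ is used. A $d$-dimensional SIC (symmetric informationally complete) set of operators is a family $\{X_x\}_{x=1}^{d^2}$ of $d^2$ rank-one positive semidefinite operators on a $d$-dimensional Hilbert space such that, for some $\lambda$, $\operatorname{Tr}[X_x]=\lambda$ for all $x$ and $\operatorname{Tr}[X_xX_y]=\frac{\lambda^2}{d+1}$ for all $x\ne y$. (Then automatically $\sum_xX_x=d\lambda\mathbb{1}$.) A SIC ensemble is a SIC set with $\lambda=\frac1{d^2}$; a SIC POVM is a SIC set with $\lambda=\frac1d$. Let $\mu$ be the unitarily invariant probability measure on unit vectors of the $d$-dimensional Hilbert space. The Scrooge POVM $\mathcal{P}^*$ is the continuous POVM $d\,|\psi\rangle\langle\psi|\,d\mu(\psi)$, and the Scrooge ensemble $\mathcal{E}^*$ is the continuous ensemble $|\psi\rangle\langle\psi|\,d\mu(\psi)$ (the index being $\psi$, or any real parametrization of it; the mutual information does not depend on the parametrization).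
   Formalization: The printed closed form for the pretty-good mutual information is false (e.g. at d=2) and is replaced by the correct value log d − ((d−1)/d) log(d+1); "strictly better" is claimed only for d ≥ 2, since at d=1 all values are 0. *)

theory Defs
  imports "HOL-Analysis.Analysis"
begin

section \<open>Operators on the Hilbert space of dimension CARD('n)\<close>

definition psd :: "complex^'n^'n \<Rightarrow> bool" where
  "psd A \<longleftrightarrow> (\<forall>v. (\<Sum>i\<in>UNIV. \<Sum>j\<in>UNIV. cnj (v $ i) * A $ i $ j * v $ j) \<in> \<real>\<^sub>\<ge>\<^sub>0)"

definition adjoint_mat :: "complex^'n^'n \<Rightarrow> complex^'n^'n" where
  "adjoint_mat A = (\<chi> i j. cnj (A $ j $ i))"

definition unitary :: "complex^'n^'n \<Rightarrow> bool" where
  "unitary U \<longleftrightarrow> U ** adjoint_mat U = mat 1 \<and> adjoint_mat U ** U = mat 1"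

definition psd_sqrt :: "complex^'n^'n \<Rightarrow> complex^'n^'n" where
  "psd_sqrt A = (THE B. psd B \<and> B ** B = A)"

definition ket_bra :: "complex^'n \<Rightarrow> complex^'n^'n" where
  "ket_bra \<psi> = (\<chi> i j. \<psi> $ i * cnj (\<psi> $ j))"


section \<open>Ensembles, POVMs, mutual information\<close>

text \<open>Families are densities with respect to a measure on the index space: a counting measure for
  discrete families, Lebesgue measure on the reals for continuous ones, and the measure on unit
  vectors for the Scrooge families.\<close>

definition ensemble :: "'x measure \<Rightarrow> ('x \<Rightarrow> complex^'n^'n) \<Rightarrow> bool" where
  "ensemble M \<rho> \<longleftrightarrow> \<rho> \<in> borel_measurable M \<and> (\<forall>x\<in>space M. psd (\<rho> x)) \<and>
     has_bochner_integral M (\<lambda>x. trace (\<rho> x)) 1"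

definition average_state :: "'x measure \<Rightarrow> ('x \<Rightarrow> complex^'n^'n) \<Rightarrow> complex^'n^'n" where
  "average_state M \<rho> = (LINT x|M. \<rho> x)"

definition povm :: "'y measure \<Rightarrow> ('y \<Rightarrow> complex^'n^'n) \<Rightarrow> bool" where
  "povm N P \<longleftrightarrow> (\<forall>y\<in>space N. psd (P y)) \<and> has_bochner_integral N P (mat 1)"

text \<open>Where the joint density vanishes the integrand is 0, since \<open>0 * _ = 0\<close>.\<close>

definition mutual_information ::
  "'x measure \<Rightarrow> ('x \<Rightarrow> complex^'n^'n) \<Rightarrow> 'y measure \<Rightarrow> ('y \<Rightarrow> complex^'n^'n) \<Rightarrow> real" where
  "mutual_information M \<rho> N P =
     (LINT (x, y)|(M \<Otimes>\<^sub>M N).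
        (let pxy = Re (trace (\<rho> x ** P y));
             px = Re (trace (\<rho> x));
             py = Re (trace (average_state M \<rho> ** P y))
         in pxy * log 2 (pxy / (px * py))))"

text \<open>The suprema are taken in the extended reals, so they need no boundedness proviso. Finite
  families are covered by the index type \<^typ>\<open>nat\<close> and families on a subset of the line by the
  index type \<^typ>\<open>real\<close>: zero operators may be added without changing the mutual information.\<close>

definition accessible_information :: "'x measure \<Rightarrow> ('x \<Rightarrow> complex^'n^'n) \<Rightarrow> ereal" where
  "accessible_information M \<rho> =
     Sup ({ereal (mutual_information M \<rho> (count_space UNIV) P) | P :: nat \<Rightarrow> complex^'n^'n.
             povm (count_space UNIV) P}
        \<union> {ereal (mutual_information M \<rho> lborel P) | P :: real \<Rightarrow> complex^'n^'n.
             povm lborel P})"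

definition informational_power :: "'y measure \<Rightarrow> ('y \<Rightarrow> complex^'n^'n) \<Rightarrow> ereal" where
  "informational_power N P =
     Sup ({ereal (mutual_information (count_space UNIV) \<rho> N P) | \<rho> :: nat \<Rightarrow> complex^'n^'n.
             ensemble (count_space UNIV) \<rho>}
        \<union> {ereal (mutual_information lborel \<rho> N P) | \<rho> :: real \<Rightarrow> complex^'n^'n.
             ensemble lborel \<rho>})"


section \<open>Pretty-good constructions\<close>

text \<open>Meaningful only if the average state is invertible.\<close>

definition pretty_good_povm :: "'x measure \<Rightarrow> ('x \<Rightarrow> complex^'n^'n) \<Rightarrow> 'x \<Rightarrow> complex^'n^'n" where
  "pretty_good_povm M \<rho> x =
     (let R = matrix_inv (psd_sqrt (average_state M \<rho>)) in R ** \<rho> x ** R)"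

definition pretty_good_ensemble ::
  "complex^'n^'n \<Rightarrow> ('y \<Rightarrow> complex^'n^'n) \<Rightarrow> 'y \<Rightarrow> complex^'n^'n" where
  "pretty_good_ensemble \<rho> P y = psd_sqrt \<rho> ** P y ** psd_sqrt \<rho>"


section \<open>SIC sets\<close>

definition sic_set :: "(nat \<Rightarrow> complex^'n^'n) \<Rightarrow> real \<Rightarrow> bool" where
  "sic_set X t \<longleftrightarrow>
     (\<forall>x\<in>{1..CARD('n)^2}. psd (X x) \<and> rank (X x) = 1 \<and> trace (X x) = of_real t) \<and>
     (\<forall>x\<in>{1..CARD('n)^2}. \<forall>y\<in>{1..CARD('n)^2}. x \<noteq> y \<longrightarrow>
        trace (X x ** X y) = of_real (t^2 / (real CARD('n) + 1)))"

definition sic_ensemble :: "(nat \<Rightarrow> complex^'n^'n) \<Rightarrow> bool" where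
  "sic_ensemble \<rho> \<longleftrightarrow> sic_set \<rho> (1 / real CARD('n)^2)"

definition sic_povm :: "(nat \<Rightarrow> complex^'n^'n) \<Rightarrow> bool" where
  "sic_povm P \<longleftrightarrow> sic_set P (1 / real CARD('n))"

abbreviation sic_index :: "nat \<Rightarrow> nat measure" where
  "sic_index d \<equiv> count_space {1..d^2}"


section \<open>Scrooge constructions\<close>

definition unitarily_invariant_prob :: "(complex^'n) measure \<Rightarrow> bool" where
  "unitarily_invariant_prob \<mu> \<longleftrightarrow>
     sets \<mu> = sets (restrict_space borel (sphere 0 1)) \<and> emeasure \<mu> (space \<mu>) = 1 \<and>
     (\<forall>U. unitary U \<longrightarrow> distr \<mu> \<mu> (\<lambda>\<psi>. U *v \<psi>) = \<mu>)"

lemma distr_lborel_isometry: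
  fixes f :: "'a::euclidean_space \<Rightarrow> 'a"
  assumes lin: "linear f" and nrm: "\<And>x. norm (f x) = norm x"
  shows "distr lborel borel f = lborel"
proof -
  interpret linear f by fact
  define \<nu> where "\<nu> = distr lborel borel f"
  have inj: "inj f" using nrm by (metis injI eq_iff_diff_eq_0 diff norm_eq_zero)
  have surj: "surj f" using lin inj linear_injective_imp_surjective by blast
  have fm[measurable]: "f \<in> borel_measurable borel"
    using lin by (intro borel_measurable_continuous_onI linear_continuous_on linear_conv_bounded_linear[THEN iffD1])
  have sets_nu[measurable_cong]: "sets \<nu> = sets borel" by (simp add: \<nu>_def)
  have inv: "emeasure \<nu> ((\<lambda>x. c + x) -` A) = emeasure \<nu> A" if [measurable]: "A \<in> sets borel" for A c
  proof -
    obtain b where b: "c = f b" using surj by blast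
    have "emeasure \<nu> ((\<lambda>x. c + x) -` A) = emeasure lborel (f -` ((\<lambda>x. c + x) -` A))"
      unfolding \<nu>_def using measurable_sets[of "\<lambda>x. c+x" borel borel A] that by (simp add: emeasure_distr)
    also have "f -` ((\<lambda>x. c + x) -` A) = (\<lambda>x. b + x) -` (f -` A)"
      by (auto simp: b add)
    also have "emeasure lborel \<dots> = emeasure (distr lborel borel ((+) b)) (f -` A)"
      using measurable_sets[OF fm that] by (simp add: emeasure_distr)
    also have "\<dots> = emeasure \<nu> A"
      using that by (simp add: lborel_distr_plus \<nu>_def emeasure_distr)
    finally show ?thesis .
  qed
  have balln: "emeasure \<nu> (ball 0 r) = emeasure lborel (ball (0::'a) r)" for r
  proof -
    have "f -` ball 0 r = ball 0 r" by (auto simp: nrm)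
    then show ?thesis by (simp add: \<nu>_def emeasure_distr)
  qed
  interpret L: sigma_finite_measure "lborel :: 'a measure" by (rule sigma_finite_lborel)
  interpret N: sigma_finite_measure \<nu>
  proof
    show "\<exists>A. countable A \<and> A \<subseteq> sets \<nu> \<and> \<Union>A = space \<nu> \<and> (\<forall>a\<in>A. emeasure \<nu> a \<noteq> \<infinity>)"
    proof (intro exI[of _ "range (\<lambda>n::nat. ball 0 (real n))"] conjI)
      show "\<Union> (range (\<lambda>n::nat. ball (0::'a) (real n))) = space \<nu>"
        using reals_Archimedean2 by (auto simp: \<nu>_def)
      show "\<forall>a\<in>range (\<lambda>n. ball 0 (real n)). emeasure \<nu> a \<noteq> \<infinity>"
        by (simp add: balln emeasure_lborel_ball_finite[THEN less_imp_neq, unfolded infinity_ennreal_def])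
    qed (auto simp: sets_nu)
  qed
  interpret P: pair_sigma_finite \<nu> "lborel :: 'a measure" ..
  define B where "B = ball (0::'a) 1"
  have Bm[measurable]: "B \<in> sets borel" by (simp add: B_def)
  have Bsym: "- x \<in> B \<longleftrightarrow> x \<in> B" for x by (simp add: B_def)
  have Bfin: "emeasure lborel B \<noteq> \<infinity>" "emeasure lborel B \<noteq> 0"
  proof -
    show "emeasure lborel B \<noteq> \<infinity>" using emeasure_lborel_ball_finite[of "0::'a" 1] by (simp add: B_def)
    show "emeasure lborel B \<noteq> 0"
      using content_ball_pos[of 1 "0::'a"] unfolding B_def measure_def by auto
  qed
  have "emeasure \<nu> A = emeasure lborel A" if Am[measurable]: "A \<in> sets borel" for A
  proof -
    have shiftN: "(\<integral>\<^sup>+x. indicator A (y + x) \<partial>\<nu>) = emeasure \<nu> A" for y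
    proof -
      have m: "(\<lambda>x. y + x) -` A \<in> sets \<nu>" using measurable_sets[of "\<lambda>x. y+x" borel borel A] by (simp add: sets_nu)
      have "(\<integral>\<^sup>+x. indicator A (y + x) \<partial>\<nu>) = (\<integral>\<^sup>+x. indicator ((\<lambda>x. y + x) -` A) x \<partial>\<nu>)"
        by (intro nn_integral_cong) (auto split: split_indicator)
      also have "\<dots> = emeasure \<nu> A" using m by (simp add: inv)
      finally show ?thesis .
    qed
    have shiftNB: "(\<integral>\<^sup>+x. indicator B (y - x) \<partial>\<nu>) = emeasure \<nu> B" for y
    proof -
      have m: "(\<lambda>x. - y + x) -` B \<in> sets \<nu>" using measurable_sets[of "\<lambda>x. - y+x" borel borel B] by (simp add: sets_nu)
      have "(\<integral>\<^sup>+x. indicator B (y - x) \<partial>\<nu>) = (\<integral>\<^sup>+x. indicator ((\<lambda>x. - y + x) -` B) x \<partial>\<nu>)"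
      proof (rule nn_integral_cong)
        fix x show "indicator B (y - x) = (indicator ((\<lambda>x. - y + x) -` B) x :: ennreal)"
          using Bsym[of "y - x"] by (auto split: split_indicator)
      qed
      also have "\<dots> = emeasure \<nu> B" using m inv[of B "- y"] by simp
      finally show ?thesis .
    qed
    have shiftL: "(\<integral>\<^sup>+y. g (x + y) \<partial>lborel) = (\<integral>\<^sup>+y. g y \<partial>lborel)"
      if [measurable]: "g \<in> borel_measurable borel" for g and x :: 'a
    proof -
      have "(\<integral>\<^sup>+y. g y \<partial>lborel) = (\<integral>\<^sup>+y. g y \<partial>distr lborel borel ((+) x))"
        by (simp add: lborel_distr_plus)
      also have "\<dots> = (\<integral>\<^sup>+y. g (x + y) \<partial>lborel)" by (subst nn_integral_distr) auto
      finally show ?thesis by simp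
    qed
    have "emeasure \<nu> A * emeasure lborel B = (\<integral>\<^sup>+y. (\<integral>\<^sup>+x. indicator A (y + x) * indicator B y \<partial>\<nu>) \<partial>lborel)"
      by (simp add: nn_integral_multc shiftN nn_integral_cmult)
    also have "\<dots> = (\<integral>\<^sup>+x. (\<integral>\<^sup>+y. indicator A (y + x) * indicator B y \<partial>lborel) \<partial>\<nu>)"
      by (rule P.Fubini') measurable
    also have "\<dots> = (\<integral>\<^sup>+x. (\<integral>\<^sup>+y. indicator A y * indicator B (y - x) \<partial>lborel) \<partial>\<nu>)"
    proof (rule nn_integral_cong)
      fix x :: 'a
      show "(\<integral>\<^sup>+y. indicator A (y + x) * indicator B y \<partial>lborel) =
            (\<integral>\<^sup>+y. indicator A y * (indicator B (y - x) :: ennreal) \<partial>lborel)"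
        using shiftL[of "\<lambda>y. indicator A y * indicator B (y - x)" x] by (simp add: add.commute)
    qed
    also have "\<dots> = (\<integral>\<^sup>+y. (\<integral>\<^sup>+x. indicator A y * indicator B (y - x) \<partial>\<nu>) \<partial>lborel)"
      by (rule P.Fubini'[symmetric]) measurable
    also have "\<dots> = emeasure lborel A * emeasure \<nu> B"
      by (simp add: nn_integral_cmult shiftNB nn_integral_multc)
    also have "emeasure \<nu> B = emeasure lborel B" by (simp add: B_def balln)
    finally have "emeasure lborel B * emeasure \<nu> A = emeasure lborel B * emeasure lborel A"
      by (simp add: mult.commute)
    then show ?thesis using Bfin by (simp add: ennreal_mult_cancel_left)
  qed
  then show ?thesis
    by (intro measure_eqI) (auto simp: \<nu>_def)
qed


lemma norm_unitary:
  fixes v :: "complex^'n"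
  assumes "unitary U"
  shows "norm (U *v v) = norm v"
proof -
  have cip: "of_real ((norm w)\<^sup>2) = (\<Sum>i\<in>UNIV. cnj (w $ i) * w $ i)" for w :: "complex^'n"
    by (simp add: norm_vec_def L2_set_def sum_nonneg complex_norm_square mult.commute del: of_real_power)
  have adj: "(adjoint_mat U *v w) $ j = (\<Sum>i\<in>UNIV. cnj (U $ i $ j) * w $ i)" for w j
    by (simp add: matrix_vector_mult_def adjoint_mat_def)
  have "(\<Sum>i\<in>UNIV. cnj ((U *v v) $ i) * (U *v v) $ i)
      = (\<Sum>i\<in>UNIV. \<Sum>j\<in>UNIV. cnj (U $ i $ j) * cnj (v $ j) * (U *v v) $ i)"
    by (simp add: matrix_vector_mult_def sum_distrib_right)
  also have "\<dots> = (\<Sum>j\<in>UNIV. \<Sum>i\<in>UNIV. cnj (U $ i $ j) * cnj (v $ j) * (U *v v) $ i)"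
    by (rule sum.swap)
  also have "\<dots> = (\<Sum>j\<in>UNIV. cnj (v $ j) * (adjoint_mat U *v (U *v v)) $ j)"
    by (simp add: adj sum_distrib_left mult_ac)
  also have "adjoint_mat U *v (U *v v) = v"
    using assms by (simp add: unitary_def matrix_vector_mul_assoc)
  finally have "of_real ((norm (U *v v))\<^sup>2) = (of_real ((norm v)\<^sup>2) :: complex)"
    by (simp only: cip)
  then show ?thesis by (simp only: of_real_eq_iff power2_eq_iff_nonneg norm_ge_zero)
qed

text \<open>The measure \<open>\<mu>\<close> exists: normalise a uniformly distributed point of the unit ball.\<close>

lemma ex_unitarily_invariant_prob: "\<exists>\<mu> :: (complex^'n) measure. unitarily_invariant_prob \<mu>"
proof -
  let ?S = "restrict_space borel (sphere 0 1) :: (complex^'n) measure"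
  define B where "B = ball (0::complex^'n) 1"
  define \<beta> where "\<beta> = uniform_measure lborel B"
  define e :: "complex^'n" where "e = axis undefined 1"
  define s where "s = (\<lambda>x::complex^'n. if x = 0 then e else sgn x)"
  have e: "norm e = 1" by (simp add: e_def norm_axis_1)
  have Bm[measurable]: "B \<in> sets borel" by (simp add: B_def)
  have B: "emeasure lborel B \<noteq> \<infinity>" "emeasure lborel B \<noteq> 0"
  proof -
    show "emeasure lborel B \<noteq> \<infinity>"
      by (simp add: B_def emeasure_lborel_ball_finite[THEN less_imp_neq, unfolded infinity_ennreal_def])
    show "emeasure lborel B \<noteq> 0"
      using content_ball_pos[of 1 "0::complex^'n"] unfolding B_def measure_def by auto
  qed
  have sets_beta[measurable_cong]: "sets \<beta> = sets borel" by (simp add: \<beta>_def)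
  have space_beta: "space \<beta> = UNIV" by (simp add: \<beta>_def)
  have beta1: "emeasure \<beta> UNIV = 1"
    using B by (simp add: \<beta>_def emeasure_uniform_measure ennreal_divide_self less_top)
  have sb[measurable]: "s \<in> borel_measurable borel"
    unfolding s_def sgn_div_norm by measurable
  have sm[measurable]: "s \<in> measurable \<beta> ?S"
    by (rule measurable_restrict_space2) (auto simp: s_def e norm_sgn)
  define \<mu> where "\<mu> = distr \<beta> ?S s"
  have mu1: "emeasure \<mu> (space \<mu>) = 1"
  proof -
    have "s -` space ?S \<inter> space \<beta> = UNIV" using measurable_space[OF sm] by (auto simp: space_beta)
    moreover have "emeasure \<mu> (space ?S) = emeasure \<beta> (s -` space ?S \<inter> space \<beta>)"
      unfolding \<mu>_def by (rule emeasure_distr[OF sm sets.top])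
    moreover have "space \<mu> = space ?S" by (simp add: \<mu>_def)
    ultimately show ?thesis by (simp add: beta1)
  qed
  have sets_mu[measurable_cong]: "sets \<mu> = sets ?S" by (simp add: \<mu>_def)
  have "distr \<mu> \<mu> (\<lambda>\<psi>. U *v \<psi>) = \<mu>" if U: "unitary U" for U :: "complex^'n^'n"
  proof -
    have lin: "linear ((*v) U)"
      by (rule linearI) (simp_all add: matrix_vector_mult_def vec_eq_iff sum.distrib scaleR_sum_right algebra_simps)
    have Um[measurable]: "(*v) U \<in> borel_measurable borel"
      using lin by (intro borel_measurable_continuous_onI linear_continuous_on linear_conv_bounded_linear[THEN iffD1])
    have US[measurable]: "(*v) U \<in> measurable ?S ?S"
      by (rule measurable_restrict_space2) (auto simp: space_restrict_space norm_unitary[OF U] intro: measurable_restrict_space1)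
    have "distr \<beta> borel ((*v) U) = \<beta>"
    proof (rule measure_eqI)
      fix A assume "A \<in> sets (distr \<beta> borel ((*v) U))"
      then have A[measurable]: "A \<in> sets borel" by simp
      have pre[measurable]: "(*v) U -` A \<in> sets borel" using measurable_sets[OF Um A] by simp
      have eq: "B \<inter> (*v) U -` A = (*v) U -` (B \<inter> A)" by (auto simp: B_def norm_unitary[OF U])
      have "emeasure (distr \<beta> borel ((*v) U)) A = emeasure \<beta> ((*v) U -` A)"
        by (simp add: emeasure_distr space_beta)
      also have "\<dots> = emeasure lborel ((*v) U -` (B \<inter> A)) / emeasure lborel B"
        by (simp add: \<beta>_def emeasure_uniform_measure eq)
      also have "emeasure lborel ((*v) U -` (B \<inter> A)) = emeasure (distr lborel borel ((*v) U)) (B \<inter> A)"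
        by (simp add: emeasure_distr)
      also have "\<dots> = emeasure lborel (B \<inter> A)"
        by (simp add: distr_lborel_isometry[OF lin norm_unitary[OF U]])
      finally show "emeasure (distr \<beta> borel ((*v) U)) A = emeasure \<beta> A"
        by (simp add: \<beta>_def emeasure_uniform_measure)
    qed (simp add: sets_beta)
    then have inv: "distr \<beta> \<beta> ((*v) U) = \<beta>" by (simp cong: distr_cong add: sets_beta)
    have U\<beta>: "(*v) U \<in> measurable \<beta> \<beta>"
      using Um measurable_cong_sets[OF sets_beta sets_beta] by simp
    have AE0: "AE x in \<beta>. x \<noteq> 0"
    proof -
      have "emeasure \<beta> {0} = emeasure lborel (B \<inter> {0}) / emeasure lborel B"
        by (simp add: \<beta>_def emeasure_uniform_measure)
      also have "emeasure lborel (B \<inter> {0}) = 0" by (rule emeasure_lborel_countable) auto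
      finally have "{0} \<in> null_sets \<beta>" by (auto simp: null_sets_def sets_beta)
      then show ?thesis using AE_not_in by fastforce
    qed
    have comm: "U *v s x = s (U *v x)" if "x \<noteq> 0" for x
    proof -
      have "U *v x \<noteq> 0" using that norm_unitary[OF U, of x] by auto
      then show ?thesis using that linear_scale[OF lin]
        by (simp add: s_def sgn_div_norm norm_unitary[OF U])
    qed
    have "distr \<mu> \<mu> (\<lambda>\<psi>. U *v \<psi>) = distr \<mu> ?S ((*v) U)" by (rule distr_cong) (simp_all add: sets_mu)
    also have "\<dots> = distr \<beta> ?S (\<lambda>x. U *v s x)"
      unfolding \<mu>_def by (simp add: distr_distr[OF US sm] o_def)
    also have "\<dots> = distr \<beta> ?S (\<lambda>x. s (U *v x))"
    proof (rule distr_cong_AE)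
      show "AE x in \<beta>. U *v s x = s (U *v x)" using AE0 by eventually_elim (rule comm)
      show "(\<lambda>x. U *v s x) \<in> measurable \<beta> ?S"
        using measurable_comp[OF sm US] by (simp add: o_def)
      show "(\<lambda>x. s (U *v x)) \<in> measurable \<beta> ?S"
        using measurable_comp[OF U\<beta> sm] by (simp add: o_def)
    qed simp_all
    also have "\<dots> = distr (distr \<beta> \<beta> ((*v) U)) ?S s"
      by (simp add: distr_distr[OF sm U\<beta>] o_def)
    finally show ?thesis by (simp add: inv \<mu>_def)
  qed
  then have "unitarily_invariant_prob \<mu>"
    unfolding unitarily_invariant_prob_def using mu1 sets_mu by blast
  then show ?thesis by blast
qed

text \<open>Densities with respect to \<open>\<mu>\<close>.\<close>

definition scrooge_povm :: "complex^'n \<Rightarrow> complex^'n^'n" where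
  "scrooge_povm \<psi> = real CARD('n) *\<^sub>R ket_bra \<psi>"

definition scrooge_ensemble :: "complex^'n \<Rightarrow> complex^'n^'n" where
  "scrooge_ensemble \<psi> = ket_bra \<psi>"


section \<open>The two values of the mutual information\<close>

definition scrooge_value :: "nat \<Rightarrow> real" where
  "scrooge_value d = log 2 (real d) - 1 / ln 2 * (\<Sum>n=2..d. 1 / real n)"

text \<open>For a SIC ensemble \<open>\<rho>\<close> and the POVM \<open>d \<rho>\<close>, the joint probability is \<open>1/d^3\<close> on the
  \<open>d^2\<close> diagonal pairs and \<open>1/(d^3 (d + 1))\<close> on the \<open>d^2 (d^2 - 1)\<close> others, and both marginals are
  uniform; the mutual information is therefore
  \<open>(1/d) log d + ((d - 1)/d) log (d/(d + 1))\<close>, which is the value below. The source prints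
  \<open>2d/(d^2 (d + 1)) log d - (d - 1)/(d^2 (d + 1)) log (d + 1)\<close> instead, which is not the mutual
  information for any \<open>d\<close> in \<open>{2..7}\<close> (for \<open>d = 2\<close>: 0.2013 against 0.2075).\<close>

definition pretty_good_value :: "nat \<Rightarrow> real" where
  "pretty_good_value d = log 2 (real d) - (real d - 1) / real d * log 2 (real d + 1)"

end

theory Submission
  imports Defs
begin

text \<open>Write \<open>q = |\<langle>\<phi>|\<psi>\<rangle>|\<^sup>2\<close> for unit vectors. Every operator that occurs is a multiple of a
  ket-bra and every average state is maximally mixed, so each mutual information reduces to sums and
  integrals of \<open>q log (d q)\<close>, and the Scrooge value to \<open>E[q ln q] = - (1/2 + \<dots> + 1/d) / d\<close>.

  Only invariance of \<open>\<mu>\<close> is used for this expectation. The integral of \<open>|\<langle>v|\<psi>\<rangle>|\<^sup>2\<^sup>k\<close> is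
  \<open>c\<^sub>k |v|\<^sup>2\<^sup>k\<close> since unitaries act transitively on spheres; differentiating twice in \<open>v\<close> and taking
  the trace gives \<open>k c\<^sub>k\<^sub>-\<^sub>1 = (d + k - 1) c\<^sub>k\<close>, that is,
  \<open>E[(1 - q) p'(q)] = (d - 1) E[p(q) - p(0)]\<close> for all polynomials \<open>p\<close>. Taking \<open>p = (1 - q)\<^sup>m\<close> and
  expanding \<open>q ln q = - \<Sum> q (1 - q)\<^sup>m / m\<close> leaves a telescoping series.

  For the lower bounds on the suprema, which range over discrete and Lebesgue-indexed families only,
  \<open>\<psi>\<close> is replaced by its orbit under the \<open>d\<^sup>2\<close> Weyl--Heisenberg operators: this is a finite POVM, and
  by invariance its information, averaged over \<open>\<psi>\<close>, is the Scrooge value.\<close>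

section \<open>Inner product and positive operators\<close>

definition cip :: "complex^'n \<Rightarrow> complex^'n \<Rightarrow> complex" where
  "cip u v = (\<Sum>i\<in>UNIV. cnj (u $ i) * v $ i)"

lemma cip_add_left: "cip (u + v) w = cip u w + cip v w"
  and cip_add_right: "cip w (u + v) = cip w u + cip w v"
  and cip_diff_left: "cip (u - v) w = cip u w - cip v w"
  and cip_diff_right: "cip w (u - v) = cip w u - cip w v"
  by (simp_all add: cip_def algebra_simps sum.distrib sum_subtractf)

lemma cip_scale_left: "cip (c *s u) v = cnj c * cip u v"
  and cip_scale_right: "cip u (c *s v) = c * cip u v"
  by (simp_all add: cip_def sum_distrib_left mult_ac)

lemma cnj_cip: "cnj (cip u v) = cip v u"
  by (simp add: cip_def mult.commute)

lemma norm_cip_commute: "cmod (cip u v) = cmod (cip v u)"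
  by (metis cnj_cip complex_mod_cnj)

lemma cip_self: "cip u u = of_real ((norm u)\<^sup>2)"
  by (simp add: cip_def norm_vec_def L2_set_def sum_nonneg complex_norm_square mult.commute
      del: of_real_power)

lemma cip_axis_right: "cip u (axis i 1) = cnj (u $ i)"
  by (simp add: cip_def axis_def if_distrib cong: if_cong)

lemma cip_axis_left: "cip (axis i 1) u = u $ i"
  by (metis cip_axis_right cnj_cip complex_cnj_cnj)

lemma norm_sq_eq_sum: "(norm u)\<^sup>2 = (\<Sum>i\<in>UNIV. (cmod (u $ i))\<^sup>2)" for u :: "complex^'n"
  by (simp add: norm_vec_def L2_set_def sum_nonneg)

lemma norm_scale: "norm (c *s u) = cmod c * norm u" for u :: "complex^'n"
  by (simp add: norm_vec_def norm_mult L2_set_right_distrib)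

lemma Cauchy_Schwarz_cip: "cmod (cip u v) \<le> norm u * norm v"
proof -
  have "cmod (cip u v) \<le> (\<Sum>i\<in>UNIV. \<bar>cmod (u $ i)\<bar> * \<bar>cmod (v $ i)\<bar>)"
    unfolding cip_def by (rule order_trans[OF norm_sum]) (simp add: norm_mult)
  also have "\<dots> \<le> norm u * norm v"
    unfolding norm_vec_def by (rule L2_set_mult_ineq)
  finally show ?thesis .
qed

lemma cip_mult_right: "cip u (A *v v) = (\<Sum>i\<in>UNIV. \<Sum>j\<in>UNIV. cnj (u $ i) * A $ i $ j * v $ j)"
  by (simp add: cip_def matrix_vector_mult_def sum_distrib_left mult.assoc)

lemma cip_adjoint: "cip u (A *v v) = cip (adjoint_mat A *v u) v"
proof -
  have "cip (adjoint_mat A *v u) v = (\<Sum>j\<in>UNIV. \<Sum>i\<in>UNIV. cnj (u $ i) * A $ i $ j * v $ j)"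
    by (simp add: cip_def matrix_vector_mult_def adjoint_mat_def sum_distrib_left sum_distrib_right mult_ac)
  also have "\<dots> = cip u (A *v v)" unfolding cip_mult_right by (rule sum.swap)
  finally show ?thesis by simp
qed

lemma cip_unitary: "unitary U \<Longrightarrow> cip (U *v u) (U *v v) = cip u v"
  by (simp add: cip_adjoint matrix_vector_mul_assoc unitary_def)

lemma matrix_eq_if_cip_eq:
  assumes "\<And>u v. cip u (A *v v) = cip u (B *v v)"
  shows "A = B"
  using assms[of "axis i 1" for i] by (simp add: cip_axis_left matrix_eq vec_eq_iff)

section \<open>Positive semidefinite matrices and their quadratic forms\<close>

lemma psd_iff: "psd A \<longleftrightarrow> (\<forall>v. cip v (A *v v) \<in> \<real>\<^sub>\<ge>\<^sub>0)"
  by (simp add: psd_def cip_mult_right)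

lemma psd_hermitian:
  assumes "psd A"
  shows "cip u (A *v v) = cnj (cip v (A *v u))"
proof -
  \<comment> \<open>polarization\<close>
  define Q where "Q u v = cip u (A *v v)" for u v
  have r: "Im (Q v v) = 0" for v
    using assms by (auto simp: psd_iff Q_def complex_nonneg_Reals_iff)
  have "Im (Q (u + v) (u + v)) = Im (Q u u) + Im (Q v v) + Im (Q u v + Q v u)"
    by (simp add: Q_def matrix_vector_right_distrib cip_add_left cip_add_right)
  then have 1: "Im (Q u v + Q v u) = 0" by (simp add: r)
  have "Im (Q (u + \<i> *s v) (u + \<i> *s v)) = Im (Q u u) + Im (Q v v) + Im (\<i> * Q u v - \<i> * Q v u)"
    by (simp add: Q_def matrix_vector_right_distrib cip_add_left cip_add_right
        cip_scale_left cip_scale_right vector_scalar_commute algebra_simps)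
  then have 2: "Re (Q u v) = Re (Q v u)" by (simp add: r)
  show ?thesis using 1 2 unfolding Q_def by (simp add: complex_eq_iff)
qed

lemma mult_axis: "(A *v axis j 1) $ i = A $ i $ j" for A :: "complex^'n^'n"
  by (simp add: matrix_vector_mult_def axis_def if_distrib cong: if_cong)

lemma psd_entry_hermitian:
  assumes "psd A"
  shows "A $ i $ j = cnj (A $ j $ i)"
  using psd_hermitian[OF assms, of "axis i 1" "axis j 1"]
  by (simp add: cip_axis_left mult_axis)

lemma psd_entry_nonneg:
  assumes "psd A"
  shows "A $ i $ i \<in> \<real>\<^sub>\<ge>\<^sub>0"
proof -
  have "cip (axis i 1) (A *v axis i 1) \<in> \<real>\<^sub>\<ge>\<^sub>0" using assms by (simp add: psd_iff)
  then show ?thesis by (simp add: cip_axis_left mult_axis)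
qed

section \<open>Rank-one positive operators as multiples of ket-bras\<close>

lemma ket_bra_mult_vec: "ket_bra u *v v = cip u v *s u"
  by (simp add: ket_bra_def cip_def matrix_vector_mult_def vec_eq_iff sum_distrib_left mult_ac)

lemma scaleR_mult_vec: "(c *\<^sub>R A) *v v = c *\<^sub>R (A *v v)" for A :: "complex^'n^'n"
  by (simp add: matrix_vector_mult_def vec_eq_iff scaleR_sum_right)

lemma cip_scaleR_right: "cip u (c *\<^sub>R v) = of_real c * cip u v" for c :: real
  unfolding cip_def vector_scaleR_component by (simp add: scaleR_conv_of_real[where 'a=complex] sum_distrib_left mult_ac)

lemma cip_ket_bra: "cip v (ket_bra u *v v) = of_real ((cmod (cip u v))\<^sup>2)"
  using cnj_cip[of u v]
  by (simp add: ket_bra_mult_vec cip_scale_right complex_norm_square del: of_real_power)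

lemma psd_scale_ket_bra: "0 \<le> c \<Longrightarrow> psd (c *\<^sub>R ket_bra u)"
  by (simp add: psd_iff scaleR_mult_vec cip_scaleR_right cip_ket_bra flip: of_real_mult)

text \<open>The row span has a one-element basis \<open>{w}\<close>, and \<open>u\<close> collects
  the coefficients of the rows in it.\<close>

lemma rank_one_factor:
  assumes "rank A = 1"
  obtains u w where "\<And>i j. A $ i $ j = u i * w $ j"
proof -
  obtain B where B: "rows A \<subseteq> vec.span B" "card B = 1"
    using vec.basis_exists[of "rows A"] assms unfolding row_rank_def_gen by metis
  obtain w where w: "B = {w}" using B(2) card_1_singletonE by blast
  have "\<exists>c. row i A = c *s w" for i
    using B(1) unfolding w vec.span_singleton rows_def by blast
  then obtain u where "row i A = u i *s w" for i by metis
  then have "A $ i $ j = u i * w $ j" for i j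
    by (metis row_def vec_lambda_eta vector_smult_component)
  then show thesis by (rule that)
qed

lemma trace_ket_bra: "trace (ket_bra u) = of_real ((norm u)\<^sup>2)"
  unfolding cip_self[symmetric] by (simp add: trace_def ket_bra_def cip_def mult.commute)

text \<open>In a rank-one factorization, Hermiticity forces the right factor to be proportional to
  the conjugate of the left one. A nonzero diagonal entry, present because the trace is nonzero,
  fixes the constant of proportionality and its sign.\<close>

lemma psd_rank_one_ket_bra:
  assumes "psd A" "rank A = 1" "trace A = of_real t" "0 < t"
  obtains \<phi> where "norm \<phi> = 1" "A = t *\<^sub>R ket_bra \<phi>"
proof -
  obtain u w where A: "\<And>i j. A $ i $ j = u i * w $ j" using rank_one_factor[OF assms(2)] by metis
  obtain k where k: "A $ k $ k \<noteq> 0"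
  proof (rule ccontr)
    assume "\<not> thesis"
    then have "trace A = 0" using that by (auto simp: trace_def intro!: sum.neutral)
    then show False using assms(3,4) by simp
  qed
  obtain a where a: "A $ k $ k = of_real a" "0 < a"
    using psd_entry_nonneg[OF assms(1), of k] k
    by (elim nonneg_Reals_cases) (metis less_eq_real_def of_real_0)
  \<comment> \<open>The value forced by the entry \<open>(k, k)\<close>, which must be
    \<open>s\<close> times the squared modulus of \<open>u k\<close>.\<close>
  define s where "s = a / (cmod (u k))\<^sup>2"
  have uk: "u k \<noteq> 0" using k by (auto simp: A)
  have s: "0 < s" using a uk by (simp add: s_def)
  have wk: "w $ k = of_real s * cnj (u k)"
  proof -
    have "of_real s * cnj (u k) * u k = of_real a"
      using uk by (simp add: s_def complex_norm_square mult.commute del: of_real_power)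
    then have "(of_real s * cnj (u k)) * u k = w $ k * u k" using a(1) by (simp add: A mult.commute)
    then show ?thesis using uk by simp
  qed
  \<comment> \<open>Comparing the entries \<open>(k, j)\<close> and \<open>(j, k)\<close> carries
    the relation from \<open>k\<close> over to every \<open>j\<close>.\<close>
  have "w $ j = of_real s * cnj (u j)" for j
    using psd_entry_hermitian[OF assms(1), of k j] uk by (simp add: A wk mult_ac)
  then have A': "A $ i $ j = of_real s * (u i * cnj (u j))" for i j
    by (simp add: A)
  \<comment> \<open>The factor \<open>sqrt (s / t)\<close> leaves exactly \<open>t\<close> in front;
    the trace condition then makes \<open>v\<close> a unit vector.\<close>
  define v where "v = (\<chi> i. of_real (sqrt (s / t)) * u i)"
  have sq: "complex_of_real (sqrt (s/t)) * of_real (sqrt (s/t)) = of_real (s/t)"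
    using s assms(4) by (simp flip: of_real_mult)
  have "A = t *\<^sub>R ket_bra v"
  proof -
    have "(t *\<^sub>R ket_bra v) $ i $ j = of_real t * (of_real (sqrt (s/t)) * of_real (sqrt (s/t))) * (u i * cnj (u j))" for i j
      by (simp add: ket_bra_def v_def scaleR_conv_of_real[where 'a=complex] mult_ac)
    then show ?thesis using assms(4) unfolding vec_eq_iff sq A' by simp
  qed
  moreover from this have "norm v = 1"
  proof -
    have "trace (t *\<^sub>R ket_bra v) = of_real t * trace (ket_bra v)"
      by (simp add: trace_def scaleR_conv_of_real[where 'a=complex] sum_distrib_left)
    then have "of_real t * of_real ((norm v)\<^sup>2) = (of_real t :: complex)"
      using assms(3) \<open>A = _\<close> trace_ket_bra by metis
    then have "t * (norm v)\<^sup>2 = t" by (metis of_real_eq_iff of_real_mult)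
    then show ?thesis using assms(4) abs_square_eq_1[of "norm v"] by simp
  qed
  ultimately show thesis using that by blast
qed

section \<open>SIC sets\<close>

lemma trace_mult: "trace (A ** B) = (\<Sum>i\<in>UNIV. \<Sum>j\<in>UNIV. A $ i $ j * B $ j $ i)"
  by (simp add: trace_def matrix_matrix_mult_def)

lemma trace_scaleR: "trace (c *\<^sub>R A) = of_real c * trace A" for A :: "complex^'n^'n"
  by (simp add: trace_def scaleR_conv_of_real[where 'a=complex] sum_distrib_left)

lemma trace_mult_scaleR_left: "trace (c *\<^sub>R A ** B) = of_real c * trace (A ** B)"
  and trace_mult_scaleR_right: "trace (A ** c *\<^sub>R B) = of_real c * trace (A ** B)"
  for A B :: "complex^'n^'n"
  by (simp_all add: trace_mult scaleR_conv_of_real[where 'a=complex] sum_distrib_left mult_ac)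

lemma trace_mult_diff_left: "trace ((A - B) ** C) = trace (A ** C) - trace (B ** C)"
  and trace_mult_diff_right: "trace (C ** (A - B)) = trace (C ** A) - trace (C ** B)"
  for A B C :: "complex^'n^'n"
  by (simp_all add: trace_mult algebra_simps sum_subtractf)

lemma trace_mult_sum_left: "trace ((\<Sum>x\<in>I. A x) ** B) = (\<Sum>x\<in>I. trace (A x ** B))"
  for B :: "complex^'n^'n"
proof (induction I rule: infinite_finite_induct)
  case (insert x I)
  then show ?case by (simp add: trace_mult distrib_right sum.distrib)
qed (simp_all add: trace_mult trace_def)

lemma trace_mult_sum_right: "trace (B ** (\<Sum>x\<in>I. A x)) = (\<Sum>x\<in>I. trace (B ** A x))"
  for B :: "complex^'n^'n"
  using trace_mult_sum_left[of A I B] by (simp only: trace_mul_sym[of B])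

lemma trace_ket_bra_mult: "trace (ket_bra u ** ket_bra v) = of_real ((cmod (cip u v))\<^sup>2)"
proof -
  have "trace (ket_bra u ** ket_bra v) = cip v u * cip u v"
    by (simp add: trace_mult ket_bra_def cip_def sum_product mult_ac)
  then show ?thesis
    by (simp add: complex_norm_square cnj_cip mult.commute del: of_real_power)
qed

text \<open>For Hermitian \<open>A\<close> the trace of the square is the squared Hilbert--Schmidt
  norm, the sum of the squared moduli of all entries.\<close>

lemma hermitian_eq_0_if_trace_square_eq_0:
  assumes herm: "\<And>i j. A $ i $ j = cnj (A $ j $ i)" and tr: "trace (A ** A) = 0"
  shows "A = 0"
proof -
  have "A $ i $ j * A $ j $ i = of_real ((cmod (A $ i $ j))\<^sup>2)" for i j
    unfolding complex_norm_square herm[of j i] ..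
  then have "trace (A ** A) = of_real (\<Sum>i\<in>UNIV. \<Sum>j\<in>UNIV. (cmod (A $ i $ j))\<^sup>2)"
    by (simp add: trace_mult)
  then have "(\<Sum>i\<in>UNIV. \<Sum>j\<in>UNIV. (cmod (A $ i $ j))\<^sup>2) = 0"
    using tr by (metis of_real_eq_0_iff)
  then have "\<forall>i. \<forall>j. (cmod (A $ i $ j))\<^sup>2 = 0"
    by (simp add: sum_nonneg_eq_0_iff sum_nonneg)
  then show ?thesis by (simp add: vec_eq_iff)
qed

lemma sic_set_ket_bra:
  fixes X :: "nat \<Rightarrow> complex^'n^'n"
  assumes "sic_set X t" "0 < t"
  obtains \<phi> where "\<And>x. x \<in> {1..CARD('n)^2} \<Longrightarrow> norm (\<phi> x) = 1"
    and "\<And>x. x \<in> {1..CARD('n)^2} \<Longrightarrow> X x = t *\<^sub>R ket_bra (\<phi> x)"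
proof -
  have "\<forall>x\<in>{1..CARD('n)^2}. \<exists>\<phi>. norm \<phi> = 1 \<and> X x = t *\<^sub>R ket_bra \<phi>"
    using assms psd_rank_one_ket_bra unfolding sic_set_def by metis
  then show thesis using that by metis
qed

text \<open>Equality holds in \<open>(tr S)\<^sup>2 \<le> d tr S\<^sup>2\<close> for \<open>S = \<Sum>\<^sub>x X x\<close>, so \<open>S\<close> is a multiple
  of the identity.\<close>

lemma sic_set_sum:
  fixes X :: "nat \<Rightarrow> complex^'n^'n"
  assumes "sic_set X t" "0 < t"
  shows "(\<Sum>x\<in>{1..CARD('n)^2}. X x) = (real CARD('n) * t) *\<^sub>R mat 1"
proof -
  let ?d = "real CARD('n)" and ?I = "{1..CARD('n)^2}"
  define S where "S = (\<Sum>x\<in>?I. X x)"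
  define s where "s = ?d * t"
  define D where "D = S - s *\<^sub>R mat 1"
  have d: "0 < ?d" by simp
  have herm: "D $ i $ j = cnj (D $ j $ i)" for i j
    using assms psd_entry_hermitian
    by (auto simp: D_def S_def sic_set_def mat_def intro!: sum.cong)
  have trS: "trace S = of_real (?d^2 * t)"
  proof -
    have "trace S = (\<Sum>x\<in>?I. trace (X x))"
      unfolding trace_def S_def sum_component by (rule sum.swap)
    also have "\<dots> = (\<Sum>x\<in>?I. of_real t)"
      using assms by (intro sum.cong) (auto simp: sic_set_def)
    finally show ?thesis by simp
  qed
  have trX: "trace (X x ** X x) = of_real (t\<^sup>2)" if "x \<in> ?I" for x
  proof -
    obtain \<phi> where "norm \<phi> = 1" "X x = t *\<^sub>R ket_bra \<phi>"
      by (metis sic_set_ket_bra[OF assms] \<open>x \<in> ?I\<close>)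
    then show ?thesis
      by (simp add: trace_mult_scaleR_left trace_mult_scaleR_right trace_ket_bra_mult cip_self power2_eq_square)
  qed
  have trSS: "trace (S ** S) = of_real (?d^3 * t\<^sup>2)"
  proof -
    have "trace (S ** S) = (\<Sum>x\<in>?I. \<Sum>y\<in>?I. trace (X x ** X y))"
      
      unfolding S_def trace_mult_sum_left trace_mult_sum_right by (rule sum.swap)
    also have "\<dots> = (\<Sum>x\<in>?I. of_real (t\<^sup>2 * ?d))"
    proof (rule sum.cong[OF refl])
      fix x assume x: "x \<in> ?I"
      \<comment> \<open>One diagonal term \<open>t^2\<close> and \<open>d^2 - 1\<close> terms
        \<open>t^2 / (d + 1)\<close>, in all \<open>d * t^2\<close>.\<close>
      have "(\<Sum>y\<in>?I. trace (X x ** X y)) = trace (X x ** X x) + (\<Sum>y\<in>?I - {x}. trace (X x ** X y))"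
        using x by (simp add: sum.remove)
      also have "(\<Sum>y\<in>?I - {x}. trace (X x ** X y)) = (\<Sum>y\<in>?I - {x}. of_real (t\<^sup>2 / (?d + 1)))"
        using assms x by (intro sum.cong) (auto simp: sic_set_def)
      also have "\<dots> = of_real ((?d^2 - 1) * (t\<^sup>2 / (?d + 1)))"
        using x by (simp add: of_nat_diff)
      also have "(?d^2 - 1) * (t\<^sup>2 / (?d + 1)) = (?d - 1) * t\<^sup>2"
        using d by (simp add: field_simps power2_eq_square)
      finally show "(\<Sum>y\<in>?I. trace (X x ** X y)) = of_real (t\<^sup>2 * ?d)"
        using x by (simp add: trX algebra_simps)
    qed
    finally show ?thesis by (simp add: power2_eq_square power3_eq_cube)
  qed
  \<comment> \<open>With \<open>s = d * t\<close> the three terms are \<open>d^3 * t^2\<close>,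
    \<open>- 2 * d^3 * t^2\<close> and \<open>d^3 * t^2\<close>.\<close>
  have "trace (D ** D) = trace (S ** S) - of_real (2 * s) * trace S + of_real (s\<^sup>2 * ?d)"
    by (simp add: D_def trace_mult_diff_left trace_mult_diff_right trace_mult_scaleR_left
        trace_mult_scaleR_right trace_sub trace_scaleR trace_I power2_eq_square algebra_simps)
  also have "\<dots> = 0"
    unfolding trSS trS s_def by (simp flip: of_real_mult of_real_add of_real_diff of_real_power add: power2_eq_square power3_eq_cube)
  finally have "D = 0" by (rule hermitian_eq_0_if_trace_square_eq_0[OF herm])
  then show ?thesis by (simp add: D_def S_def s_def)
qed

section \<open>Square roots and inverses of scalar matrices\<close>

lemma psd_sqrt_scalar:
  assumes "0 < c"
  shows "psd_sqrt (c *\<^sub>R mat 1 :: complex^'n^'n) = sqrt c *\<^sub>R mat 1"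
  unfolding psd_sqrt_def
proof (rule the_equality)
  have "cip v ((sqrt c *\<^sub>R mat 1) *v v) = of_real (sqrt c * (norm v)\<^sup>2)" for v :: "complex^'n"
    by (simp add: scaleR_mult_vec cip_scaleR_right cip_self)
  then have "psd (sqrt c *\<^sub>R mat 1 :: complex^'n^'n)"
    using assms unfolding psd_iff by (metis less_imp_le mult_nonneg_nonneg nonneg_Reals_of_real_iff real_sqrt_ge_zero zero_le_power2)
  then show "psd (sqrt c *\<^sub>R mat 1 :: complex^'n^'n) \<and> (sqrt c *\<^sub>R mat 1) ** (sqrt c *\<^sub>R mat 1) = (c *\<^sub>R mat 1 :: complex^'n^'n)"
    using assms by (simp add: matrix_scalar_ac scalar_matrix_assoc)
next
  fix B :: "complex^'n^'n"
  assume B: "psd B \<and> B ** B = c *\<^sub>R mat 1"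
  have "B *v v = sqrt c *\<^sub>R v" for v
  proof -
    \<comment> \<open>Uniqueness of the root: this \<open>w\<close> satisfies
      \<open>B w = - sqrt c w\<close>, and a positive semidefinite \<open>B\<close> has no negative
      eigenvalue, so \<open>w = 0\<close>.\<close>
    define w where "w = B *v v - sqrt c *\<^sub>R v"
    have "B *v (B *v v) = c *\<^sub>R v"
      using B by (simp add: matrix_vector_mul_assoc scaleR_mult_vec)
    moreover have "B *v (sqrt c *\<^sub>R v) = sqrt c *\<^sub>R (B *v v)"
      by (simp add: matrix_vector_mult_def vec_eq_iff scaleR_sum_right)
    moreover have "c = sqrt c * sqrt c" using assms by simp
    ultimately have "B *v w = - sqrt c *\<^sub>R w"
      unfolding w_def matrix_vector_mult_diff_distrib by (simp add: scaleR_diff_right)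
    then have "cip w (B *v w) = of_real (- sqrt c * (norm w)\<^sup>2)"
      by (simp add: cip_scaleR_right cip_self del: scaleR_minus_left)
    then have "0 \<le> - sqrt c * (norm w)\<^sup>2"
      using B unfolding psd_iff by (metis nonneg_Reals_of_real_iff)
    then have "norm w = 0"
      using assms by (simp add: mult_le_0_iff)
    then show ?thesis by (simp add: w_def)
  qed
  then show "B = sqrt c *\<^sub>R mat 1"
    by (simp add: matrix_eq scaleR_mult_vec)
qed

lemma matrix_inv_eqI:
  fixes A B :: "complex^'n^'n"
  assumes "A ** B = mat 1" "B ** A = mat 1"
  shows "matrix_inv A = B"
proof -
  have "A ** matrix_inv A = mat 1 \<and> matrix_inv A ** A = mat 1"
    unfolding matrix_inv_def by (rule someI[of _ B]) (use assms in blast)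
  then show ?thesis
    by (metis assms(2) matrix_mul_assoc matrix_mul_lid matrix_mul_rid)
qed

section \<open>Unitary operators\<close>

lemma mod_add_right_inj:
  assumes "(a + m) mod d = (b + m) mod d" "a < d" "b < (d::nat)"
  shows "a = b"
proof -
  have "a = b" if "a \<le> b" "(b + m) mod d = (a + m) mod d" "b < d" for a b
  proof -
    have "d dvd (b + m) - (a + m)" using that mod_eq_dvd_iff_nat[of "a + m" "b + m" d] by simp
    then show ?thesis using that nat_dvd_not_less[of "b - a" d] by fastforce
  qed
  then show ?thesis using assms by (metis linear)
qed

text \<open>Orthogonality of the characters of the cyclic group: the sum is geometric with ratio
  \<open>r\<close>, a \<open>d\<close>-th root of unity that equals 1 only for
  \<open>a = b\<close>.\<close>

lemma sum_powers_roots_of_unity: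
  assumes "a < d" "b < d"
  shows "(\<Sum>j<d. cis (2 * pi * real a / real d) ^ j * cnj (cis (2 * pi * real b / real d) ^ j))
       = (if a = b then of_nat d else 0)"
proof -
  let ?w = "\<lambda>a. cis (2 * pi * real a / real d)"
  define r where "r = ?w a * cnj (?w b)"
  have d: "0 < d" using assms by simp
  have wd: "?w a ^ d = 1" for a
  proof -
    have "?w a ^ d = cis (real d * (2 * pi * real a / real d))" by (rule Complex.DeMoivre)
    also have "\<dots> = cis (2 * pi * real a)" using d by simp
    finally show ?thesis by simp
  qed
  have "r ^ d = ?w a ^ d * cnj (?w b ^ d)" by (simp add: r_def power_mult_distrib)
  then have rd: "r ^ d = 1" by (simp only: wd) simp
  have sum: "(\<Sum>j<d. ?w a ^ j * cnj (?w b ^ j)) = (\<Sum>j<d. r ^ j)"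
    by (simp add: r_def power_mult_distrib)
  have r1: "r = 1 \<longleftrightarrow> ?w a = ?w b"
  proof -
    have u: "cnj (?w b) * ?w b = 1" by (simp add: cis_cnj cis_mult)
    then have "r * ?w b = ?w a" by (simp add: r_def mult.assoc)
    then show ?thesis using u unfolding r_def by (metis mult.commute mult_1)
  qed
  have inj: "?w a = ?w b \<longleftrightarrow> a = b"
    using Complex.bij_betw_roots_unity[OF d] assms by (auto simp: bij_betw_def inj_on_def)
  show ?thesis
  proof (cases "a = b")
    case True
    then show ?thesis unfolding sum using r1 by simp
  next
    case False
    then show ?thesis unfolding sum using r1 inj rd by (simp add: geometric_sum)
  qed
qed

text \<open>The Weyl--Heisenberg operators: products of the powers of a cyclic shift and of the diagonal
  matrix of \<open>d\<close>-th roots of unity.\<close>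

lemma ex_Weyl_Heisenberg:
  obtains V :: "nat \<Rightarrow> complex^'n^'n" where "\<And>k. unitary (V k)"
    and "\<And>v. (\<Sum>k<CARD('n)^2. ket_bra (V k *v v)) = (real CARD('n) * (norm v)\<^sup>2) *\<^sub>R mat 1"
proof -
  define d where "d = CARD('n)"
  \<comment> \<open>A numbering of the basis by the residues modulo \<open>d\<close>, on which a
    cyclic shift makes sense.\<close>
  obtain g where g: "bij_betw g (UNIV :: 'n set) {..<d}"
    using ex_bij_betw_finite_nat[of "UNIV :: 'n set"] by (auto simp: d_def atLeast0LessThan)
  have gd: "g i < d" for i using g by (auto simp: bij_betw_def)
  have g_eq: "g i = g j \<longleftrightarrow> i = j" for i j using g by (auto simp: bij_betw_def inj_def)
  have d: "0 < d" by (simp add: d_def)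
  define s where "s m i = the_inv g ((g i + m) mod d)" for m i
  have gs: "g (s m i) = (g i + m) mod d" for m i
  proof -
    have "(g i + m) mod d \<in> range g" using g d by (auto simp: bij_betw_def)
    then show ?thesis unfolding s_def using g by (intro f_the_inv_into_f) (auto simp: bij_betw_def)
  qed
  have s_inj: "s m i = s m j \<longleftrightarrow> i = j" for m i j
    using mod_add_right_inj gd by (metis gs g_eq)
  have s_bij: "bij_betw (\<lambda>m. s m i) {..<d} UNIV" for i
  proof -
    have "inj_on (\<lambda>m. s m i) {..<d}"
    proof (rule inj_onI)
      fix m n assume "m \<in> {..<d}" "n \<in> {..<d}" "s m i = s n i"
      then show "m = n" using mod_add_right_inj[of m "g i" d n] gs[of m i] gs[of n i]
        by (simp add: add.commute)
    qed
    moreover have "card ((\<lambda>m. s m i) ` {..<d}) = CARD('n)"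
      using card_image[OF calculation] by (simp add: d_def)
    then have "(\<lambda>m. s m i) ` {..<d} = UNIV" by (intro card_subset_eq) auto
    ultimately show ?thesis by (simp add: bij_betw_def)
  qed
  define w where "w i = cis (2 * pi * real (g i) / real d)" for i
  have w1: "w i * cnj (w i) = 1" for i by (simp add: w_def cis_cnj cis_mult)
  \<comment> \<open>\<open>j\<close> is the power of the phase matrix and \<open>m\<close> the power
    of the shift.\<close>
  define W :: "nat \<times> nat \<Rightarrow> complex^'n^'n" where
    "W = (\<lambda>(j, m). \<chi> i l. if l = s m i then w i ^ j else 0)"
  have Wv: "(W (j, m) *v v) $ i = w i ^ j * v $ s m i" for j m v i
    by (simp add: W_def matrix_vector_mult_def if_distribR if_distrib cong: if_cong)
  have uni: "unitary (W p)" for p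
  proof -
    obtain j m where p: "p = (j, m)" by (cases p)
    have "(W p ** adjoint_mat (W p)) $ i $ l = mat 1 $ i $ l" for i l
    proof -
      have "(W p ** adjoint_mat (W p)) $ i $ l
          = (\<Sum>k\<in>UNIV. if k = s m i then (if s m i = s m l then w i ^ j * cnj (w l ^ j) else 0) else 0)"
      proof -
        have "(W p ** adjoint_mat (W p)) $ i $ l
            = (\<Sum>k\<in>UNIV. (if k = s m i then w i ^ j else 0) * cnj (if k = s m l then w l ^ j else 0))"
          by (simp add: matrix_matrix_mult_def adjoint_mat_def W_def p)
        also have "\<dots> = (\<Sum>k\<in>UNIV. if k = s m i then (if s m i = s m l then w i ^ j * cnj (w l ^ j) else 0) else 0)"
          by (rule sum.cong[OF refl]) auto
        finally show ?thesis .
      qed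
      also have "\<dots> = (if i = l then (w i * cnj (w i)) ^ j else 0)"
        by (simp add: s_inj power_mult_distrib)
      finally show ?thesis by (simp add: w1 mat_def)
    qed
    then have "W p ** adjoint_mat (W p) = mat 1" by (simp add: vec_eq_iff)
    then show ?thesis by (simp add: unitary_def matrix_left_right_inverse)
  qed
  \<comment> \<open>In the entry \<open>(i, l)\<close> the sum over the phases \<open>j\<close>
    vanishes off the diagonal. On the diagonal the shifts \<open>m\<close> carry \<open>i\<close> to
    every coordinate exactly once, which produces the squared norm.\<close>
  have sum_W: "(\<Sum>p\<in>{..<d} \<times> {..<d}. ket_bra (W p *v v)) = (real d * (norm v)\<^sup>2) *\<^sub>R mat 1" for v
  proof -
    have "(\<Sum>p\<in>{..<d} \<times> {..<d}. ket_bra (W p *v v)) $ i $ l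
        = ((real d * (norm v)\<^sup>2) *\<^sub>R mat 1) $ i $ l" for i l
    proof -
      have "(\<Sum>p\<in>{..<d} \<times> {..<d}. ket_bra (W p *v v)) $ i $ l
          = (\<Sum>j<d. \<Sum>m<d. (w i ^ j * cnj (w l ^ j)) * (v $ s m i * cnj (v $ s m l)))"
        by (simp add: sum.cartesian_product ket_bra_def Wv case_prod_unfold mult_ac)
          (auto intro!: sum.cong simp: Wv mult_ac)
      also have "\<dots> = (\<Sum>j<d. w i ^ j * cnj (w l ^ j)) * (\<Sum>m<d. v $ s m i * cnj (v $ s m l))"
        by (simp only: sum_product)
      also have "(\<Sum>j<d. w i ^ j * cnj (w l ^ j)) = (if i = l then of_nat d else 0)"
        unfolding w_def by (simp only: sum_powers_roots_of_unity[OF gd gd] g_eq)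
      also have "\<dots> * (\<Sum>m<d. v $ s m i * cnj (v $ s m l))
          = (if i = l then of_nat d * (\<Sum>m<d. of_real ((cmod (v $ s m i))\<^sup>2)) else 0)"
        by (simp add: complex_norm_square del: of_real_power)
      also have "(\<Sum>m<d. complex_of_real ((cmod (v $ s m i))\<^sup>2)) = (\<Sum>k\<in>UNIV. of_real ((cmod (v $ k))\<^sup>2))"
        by (rule sum.reindex_bij_betw[OF s_bij])
      also have "\<dots> = of_real ((norm v)\<^sup>2)" by (simp add: norm_sq_eq_sum)
      finally show ?thesis by (simp add: mat_def scaleR_conv_of_real[where 'a=complex])
    qed
    then show ?thesis by (simp add: vec_eq_iff)
  qed
  obtain b where b: "bij_betw b {..<d^2} ({..<d} \<times> {..<d})"
    using ex_bij_betw_nat_finite[of "{..<d} \<times> {..<d}"]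
    by (auto simp: atLeast0LessThan card_cartesian_product power2_eq_square)
  have "(\<Sum>k<d^2. ket_bra (W (b k) *v v)) = (real d * (norm v)\<^sup>2) *\<^sub>R mat 1" for v
    using sum.reindex_bij_betw[OF b, of "\<lambda>p. ket_bra (W p *v v)"] sum_W by simp
  then show thesis using that[of "\<lambda>k. W (b k)"] uni unfolding d_def by blast
qed

section \<open>Transitivity of the unitary group on spheres, up to a phase\<close>

lemma adjoint_mat_eqI:
  assumes "\<And>u v. cip (B *v u) v = cip u (A *v v)"
  shows "adjoint_mat A = B"
proof (rule matrix_eq_if_cip_eq)
  fix u v
  show "cip u (adjoint_mat A *v v) = cip u (B *v v)"
    using assms[of v u] cip_adjoint[of v A u] by (metis cnj_cip)
qed

text \<open>A Householder reflection, after \<open>w\<close> is rotated by a phase so that \<open>cip w v\<close> is real.\<close>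

lemma ex_unitary_up_to_phase:
  fixes v w :: "complex^'n"
  assumes "norm v = norm w"
  obtains U \<alpha> where "unitary U" "cmod \<alpha> = 1" "U *v v = \<alpha> *s w"
proof -
  obtain \<alpha> r where \<alpha>: "cmod \<alpha> = 1" "cnj \<alpha> * cip w v = of_real r"
  proof (cases "cip w v = 0")
    case True
    then show ?thesis using that[of 1 0] by simp
  next
    case False
    let ?c = "cip w v"
    have "cnj (sgn ?c) * ?c = of_real (cmod ?c)"
      using False complex_norm_square[of ?c]
      by (simp add: sgn_eq mult.commute divide_simps power2_eq_square)
    then show ?thesis using that[of "sgn ?c" "cmod ?c"] False by (simp add: norm_sgn)
  qed
  \<comment> \<open>The reflection that negates \<open>u\<close> and fixes its orthogonal complement
    exchanges \<open>v\<close> and \<open>\<alpha> *s w\<close>.\<close>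
  define u where "u = v - \<alpha> *s w"
  show thesis
  proof (cases "u = 0")
    case True
    have "adjoint_mat (mat 1 :: complex^'n^'n) = mat 1" by (rule adjoint_mat_eqI) simp
    then have "unitary (mat 1 :: complex^'n^'n)" by (simp add: unitary_def)
    then show thesis using that[of "mat 1" \<alpha>] True \<alpha>(1) by (simp add: u_def)
  next
    case False
    define s where "s = 2 / (norm u)\<^sup>2"
    have s: "complex_of_real s * cip u u = 2" using False by (simp add: s_def cip_self)
    define U where "U = mat 1 - s *\<^sub>R ket_bra u"
    have U: "U *v x = x - (of_real s * cip u x) *s u" for x
      by (simp add: U_def matrix_vector_mult_diff_rdistrib scaleR_mult_vec ket_bra_mult_vec
          vec_eq_iff scaleR_conv_of_real[where 'a=complex])
    have "adjoint_mat U = U"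
      by (rule adjoint_mat_eqI)
        (simp add: U cip_diff_left cip_diff_right cip_scale_left cip_scale_right cnj_cip mult_ac)
    moreover have "U *v (U *v x) = x" for x
    proof -
      have "cip u (U *v x) = cip u x - (of_real s * cip u u) * cip u x"
        by (simp add: U cip_diff_right cip_scale_right mult_ac)
      then have "cip u (U *v x) = - cip u x" by (simp add: s)
      then show ?thesis by (simp add: U[of "U *v x"]) (simp add: U vec_eq_iff)
    qed
    then have "U ** U = mat 1" by (simp add: matrix_eq matrix_vector_mul_assoc[symmetric])
    ultimately have "unitary U" by (simp add: unitary_def)
    \<comment> \<open>Here the phase matters: the inner product of \<open>\<alpha> *s w\<close> and
      \<open>v\<close> is real and both norms agree, hence
      \<open>cip u u = 2 * cip u v\<close>.\<close>
    moreover have "of_real s * cip u v = 1"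
    proof -
      have wv: "cip (\<alpha> *s w) v = of_real r" using \<alpha>(2) by (simp add: cip_scale_left)
      then have vw: "cip v (\<alpha> *s w) = of_real r" by (metis cnj_cip complex_cnj_complex_of_real)
      have ww: "cip (\<alpha> *s w) (\<alpha> *s w) = cip v v" using \<alpha>(1) assms by (simp add: cip_self norm_scale)
      have "cip u u = 2 * cip u v"
        by (simp add: u_def cip_diff_left cip_diff_right wv vw ww)
      then show ?thesis using s by simp
    qed
    then have "U *v v = \<alpha> *s w" by (simp add: U u_def)
    ultimately show thesis using that \<alpha>(1) by blast
  qed
qed

section \<open>Moments of the overlap with a fixed vector\<close>

lemma continuous_on_cip [continuous_intros]:
  "continuous_on S f \<Longrightarrow> continuous_on S g \<Longrightarrow> continuous_on S (\<lambda>x. cip (f x) (g x))"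
  unfolding cip_def by (intro continuous_intros)

section \<open>Integration against the invariant measure\<close>

lemma space_invariant:
  "unitarily_invariant_prob \<mu> \<Longrightarrow> space \<mu> = sphere 0 1"
  unfolding unitarily_invariant_prob_def
  by (metis Int_UNIV_right sets_eq_imp_space_eq space_borel space_restrict_space)

lemma finite_measure_invariant: "unitarily_invariant_prob \<mu> \<Longrightarrow> finite_measure \<mu>"
  by (rule finite_measureI) (simp add: unitarily_invariant_prob_def)

lemma measure_space_invariant: "unitarily_invariant_prob \<mu> \<Longrightarrow> measure \<mu> (space \<mu>) = 1"
  by (simp add: measure_def unitarily_invariant_prob_def)

lemma borel_measurable_invariant:
  assumes "unitarily_invariant_prob \<mu>" "f \<in> borel_measurable borel"
  shows "f \<in> borel_measurable \<mu>"
  using measurable_restrict_space1[OF assms(2), of "sphere 0 1"] assms(1)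
  by (simp add: unitarily_invariant_prob_def cong: measurable_cong_sets)

text \<open>Continuous functions are bounded on the compact unit sphere, and the measure is
  finite.\<close>

lemma integrable_invariant:
  fixes f :: "complex^'n \<Rightarrow> 'b::euclidean_space"
  assumes "unitarily_invariant_prob \<mu>" "continuous_on UNIV f"
  shows "integrable \<mu> f"
proof -
  interpret finite_measure \<mu> using assms(1) by (rule finite_measure_invariant)
  have "compact (f ` sphere 0 1)"
    using assms(2) by (intro compact_continuous_image) (auto intro: continuous_on_subset)
  then have "bounded (f ` sphere 0 1)" by (rule compact_imp_bounded)
  then obtain B where "\<forall>y\<in>f ` sphere 0 1. norm y \<le> B"
    unfolding bounded_iff by blast
  then have "AE x in \<mu>. norm (f x) \<le> B"
    by (intro AE_I2) (simp add: space_invariant[OF assms(1)])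
  moreover have "f \<in> borel_measurable \<mu>"
    by (rule borel_measurable_invariant[OF assms(1) borel_measurable_continuous_onI[OF assms(2)]])
  ultimately show ?thesis by (rule integrable_const_bound)
qed

lemma measurable_unitary:
  fixes \<mu> :: "(complex^'n) measure"
  assumes \<mu>: "unitarily_invariant_prob \<mu>" and U: "unitary U"
  shows "(*v) U \<in> measurable \<mu> \<mu>"
proof -
  have "continuous_on UNIV ((*v) U)"
    unfolding matrix_vector_mult_def by (intro continuous_intros)
  then have "(*v) U \<in> measurable \<mu> borel"
    by (intro borel_measurable_invariant[OF \<mu>] borel_measurable_continuous_onI)
  then have "(*v) U \<in> measurable \<mu> (restrict_space borel (sphere 0 1))"
    by (rule measurable_restrict_space2[rotated]) (auto simp: space_invariant[OF \<mu>] norm_unitary[OF U])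
  then show ?thesis
    using \<mu> by (simp add: unitarily_invariant_prob_def cong: measurable_cong_sets)
qed

lemma integral_unitary:
  fixes f :: "complex^'n \<Rightarrow> real"
  assumes \<mu>: "unitarily_invariant_prob \<mu>" and f: "f \<in> borel_measurable borel" and U: "unitary U"
  shows "(\<integral>\<psi>. f (U *v \<psi>) \<partial>\<mu>) = (\<integral>\<psi>. f \<psi> \<partial>\<mu>)"
proof -
  have "(\<integral>\<psi>. f \<psi> \<partial>\<mu>) = (\<integral>\<psi>. f \<psi> \<partial>distr \<mu> \<mu> ((*v) U))"
    using \<mu> U by (simp add: unitarily_invariant_prob_def)
  also have "\<dots> = (\<integral>\<psi>. f (U *v \<psi>) \<partial>\<mu>)"
    using measurable_unitary[OF \<mu> U] borel_measurable_invariant[OF \<mu> f] by (rule integral_distr)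
  finally show ?thesis by simp
qed

text \<open>A unitary takes \<open>v\<close> to a phase times \<open>norm v\<close> times a fixed
  unit vector \<open>e\<close>. Invariance absorbs the unitary into the integration variable and the
  modulus removes the phase, so \<open>c\<close> is the moment of \<open>e\<close>.\<close>

lemma moment_homogeneous:
  fixes \<mu> :: "(complex^'n) measure"
  assumes \<mu>: "unitarily_invariant_prob \<mu>"
  obtains c where "\<And>v. (\<integral>\<psi>. ((cmod (cip v \<psi>))\<^sup>2) ^ k \<partial>\<mu>) = c * ((norm v)\<^sup>2) ^ k"
proof
  fix v :: "complex^'n"
  define e :: "complex^'n" where "e = axis undefined 1"
  let ?f = "\<lambda>v \<psi>. ((cmod (cip v \<psi>))\<^sup>2) ^ k"
  have "norm v = norm (of_real (norm v) *s e)" by (simp add: norm_scale e_def norm_axis_1)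
  then obtain U \<alpha> where U: "unitary U" "cmod \<alpha> = 1" "U *v v = \<alpha> *s (of_real (norm v) *s e)"
    by (rule ex_unitary_up_to_phase)
  have "continuous_on UNIV (?f w)" for w :: "complex^'n" by (intro continuous_intros)
  then have m: "?f w \<in> borel_measurable borel" for w :: "complex^'n"
    by (rule borel_measurable_continuous_onI)
  have "(\<integral>\<psi>. ?f v \<psi> \<partial>\<mu>) = (\<integral>\<psi>. ?f (U *v v) (U *v \<psi>) \<partial>\<mu>)"
    by (simp add: cip_unitary[OF U(1)])
  also have "\<dots> = (\<integral>\<psi>. ?f (U *v v) \<psi> \<partial>\<mu>)"
    by (rule integral_unitary[OF \<mu> m U(1)])
  also have "\<dots> = (\<integral>\<psi>. ?f e \<psi> * ((norm v)\<^sup>2) ^ k \<partial>\<mu>)"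
    unfolding U(3) cip_scale_left by (simp add: norm_mult U(2) power_mult_distrib mult.commute)
  also have "\<dots> = (\<integral>\<psi>. ?f e \<psi> \<partial>\<mu>) * ((norm v)\<^sup>2) ^ k" by simp
  finally show "(\<integral>\<psi>. ?f v \<psi> \<partial>\<mu>) = (\<integral>\<psi>. ?f e \<psi> \<partial>\<mu>) * ((norm v)\<^sup>2) ^ k" .
qed

section \<open>Coefficients of polynomials that depend on a parameter\<close>

lemma coeff_quadratic_power_0: "coeff ([:a, b, c:] ^ k) 0 = a ^ k" for a :: real
  by (induction k) (simp_all add: coeff_mult)

lemma coeff_quadratic_power_1: "coeff ([:a, b, c:] ^ k) (Suc 0) = real k * a ^ (k - 1) * b" for a :: real
proof (induction k)
  case (Suc k)
  have "coeff ([:a, b, c:] ^ Suc k) (Suc 0) = a * coeff ([:a, b, c:] ^ k) (Suc 0) + b * coeff ([:a, b, c:] ^ k) 0"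
    by (simp add: coeff_mult)
  then show ?case unfolding Suc.IH coeff_quadratic_power_0
    by (cases k) (simp_all add: algebra_simps)
qed simp

text \<open>The truncated exponents \<open>k - 1\<close> and \<open>k - 2\<close> do no harm: where
  they truncate, they are multiplied by a zero factor.\<close>

lemma coeff_quadratic_power_2:
  "coeff ([:a, b, c:] ^ k) 2 = real k * a ^ (k - 1) * c + real k * (real k - 1) / 2 * a ^ (k - 2) * b\<^sup>2"
  for a :: real
proof (induction k)
  case (Suc k)
  have "coeff ([:a, b, c:] ^ Suc k) 2 = a * coeff ([:a, b, c:] ^ k) 2
      + b * coeff ([:a, b, c:] ^ k) (Suc 0) + c * coeff ([:a, b, c:] ^ k) 0"
    by (simp add: coeff_mult numeral_2_eq_2)
  then have *: "coeff ([:a, b, c:] ^ Suc k) 2 = a * (real k * a ^ (k - 1) * c + real k * (real k - 1) / 2 * a ^ (k - 2) * b\<^sup>2)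
      + b * (real k * a ^ (k - 1) * b) + c * a ^ k"
    unfolding Suc.IH coeff_quadratic_power_0 coeff_quadratic_power_1 .
  consider "k = 0" | "k = 1" | m where "k = Suc (Suc m)" by (metis One_nat_def not0_implies_Suc)
  then show ?case
  proof cases
    case 3
    then show ?thesis unfolding * by (simp add: field_simps power2_eq_square)
  qed (simp_all add: * power2_eq_square numeral_2_eq_2)
qed simp

text \<open>Stands in for differentiation under the integral. The uniform degree bound
  \<open>N\<close> makes each integrand a finite sum, so the integral is a polynomial in
  \<open>t\<close> with the integrated coefficients, and equal polynomial functions have equal
  coefficients.\<close>

lemma integral_coeff:
  fixes p :: "'a \<Rightarrow> real poly"
  assumes "\<And>x. degree (p x) \<le> N" and int: "\<And>n. integrable M (\<lambda>x. coeff (p x) n)"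
    and eq: "\<And>t. (\<integral>x. poly (p x) t \<partial>M) = poly q t"
  shows "(\<integral>x. coeff (p x) n \<partial>M) = coeff q n"
proof -
  define r where "r = (\<Sum>n\<le>N. monom (\<integral>x. coeff (p x) n \<partial>M) n)"
  have "poly r t = poly q t" for t
  proof -
    have "poly (p x) t = (\<Sum>n\<le>N. coeff (p x) n * t ^ n)" for x
      using arg_cong[OF poly_as_sum_of_monoms'[OF assms(1)[of x]], of "\<lambda>p. poly p t"]
      by (simp add: poly_sum poly_monom)
    then have "(\<integral>x. poly (p x) t \<partial>M) = (\<Sum>n\<le>N. (\<integral>x. coeff (p x) n * t ^ n \<partial>M))"
      using int by simp
    then show ?thesis unfolding r_def eq[symmetric] by (simp add: poly_sum poly_monom)
  qed
  then have "r = q" by (metis poly_eq_poly_eq_iff ext)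
  moreover have "coeff r n = (\<integral>x. coeff (p x) n \<partial>M)"
  proof (cases "n \<le> N")
    case False
    then have "coeff (p x) n = 0" for x using assms(1)[of x] by (simp add: coeff_eq_0)
    then show ?thesis using False by (simp add: r_def coeff_sum)
  qed (simp add: r_def coeff_sum)
  ultimately show ?thesis by simp
qed

lemma continuous_on_coeff_pCons:
  fixes p :: "'a::topological_space \<Rightarrow> real poly"
  assumes "continuous_on S a" "\<And>n. continuous_on S (\<lambda>x. coeff (p x) n)"
  shows "continuous_on S (\<lambda>x. coeff (pCons (a x) (p x)) n)"
  using assms by (cases n) simp_all

lemma continuous_on_coeff_mult:
  fixes p q :: "'a::topological_space \<Rightarrow> real poly"
  assumes "\<And>n. continuous_on S (\<lambda>x. coeff (p x) n)" "\<And>n. continuous_on S (\<lambda>x. coeff (q x) n)"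
  shows "continuous_on S (\<lambda>x. coeff (p x * q x) n)"
  unfolding coeff_mult by (intro continuous_intros assms)

lemma continuous_on_coeff_power:
  fixes p :: "'a::topological_space \<Rightarrow> real poly"
  assumes "\<And>n. continuous_on S (\<lambda>x. coeff (p x) n)"
  shows "continuous_on S (\<lambda>x. coeff (p x ^ k) n)"
proof (induction k arbitrary: n)
  case (Suc k)
  then show ?case unfolding power_Suc by (intro continuous_on_coeff_mult assms)
qed simp

section \<open>Second-order expansion and the moment recurrence\<close>

lemma poly_quadratic: "poly [:a, b, c:] t = a + t * b + t\<^sup>2 * c" for t :: "'a::comm_ring_1"
  by (simp add: power2_eq_square algebra_simps)

lemma norm_add_scaled_sq: "(cmod (x + of_real t * y))\<^sup>2 = (cmod x)\<^sup>2 + t * (2 * Re (cnj x * y)) + t\<^sup>2 * (cmod y)\<^sup>2"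
  unfolding cmod_power2 by (simp add: power2_eq_square algebra_simps)

text \<open>Compare the coefficients of \<open>t\<^sup>2\<close> in the homogeneity relation at \<open>v = \<phi> + t z e\<^sub>j\<close>; the
  sum over \<open>z = 1, \<i>\<close> removes the cross terms, the sum over \<open>j\<close> the dependence on the basis.\<close>

lemma moment_recurrence:
  fixes \<phi> :: "complex^'n"
  assumes \<mu>: "unitarily_invariant_prob \<mu>" and \<phi>: "norm \<phi> = 1"
  shows "real (Suc m) * (\<integral>\<psi>. ((cmod (cip \<phi> \<psi>))\<^sup>2) ^ m \<partial>\<mu>)
       = (real CARD('n) + real m) * (\<integral>\<psi>. ((cmod (cip \<phi> \<psi>))\<^sup>2) ^ Suc m \<partial>\<mu>)"
proof -
  define k where "k = Suc m"
  define a where "a \<psi> = (cmod (cip \<phi> \<psi>))\<^sup>2" for \<psi>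
  obtain c where c: "\<And>v. (\<integral>\<psi>. ((cmod (cip v \<psi>))\<^sup>2) ^ k \<partial>\<mu>) = c * ((norm v)\<^sup>2) ^ k"
    using moment_homogeneous[OF \<mu>, where k = k] by metis
  have ck: "c = (\<integral>\<psi>. a \<psi> ^ k \<partial>\<mu>)" using c[of \<phi>] by (simp add: \<phi> a_def)
  have cont_a: "continuous_on UNIV a" unfolding a_def by (intro continuous_intros)
  have int: "integrable \<mu> f" if "continuous_on UNIV f" for f :: "complex^'n \<Rightarrow> real"
    using \<mu> that by (rule integrable_invariant)
  have coef: "(\<integral>\<psi>. real k * a \<psi> ^ (k - 1) * (cmod (\<psi> $ j))\<^sup>2
        + real k * (real k - 1) / 2 * a \<psi> ^ (k - 2) * (2 * Re (cnj (cip \<phi> \<psi>) * (cnj z * \<psi> $ j)))\<^sup>2 \<partial>\<mu>)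
      = c * (real k + real k * (real k - 1) / 2 * (2 * Re (cnj z * \<phi> $ j))\<^sup>2)"
    if z: "cmod z = 1" for z j
  proof -
    \<comment> \<open>As quadratics in \<open>t\<close>, these are the squared overlap with
      \<open>\<psi>\<close> and the squared norm of the vector \<open>v\<close> defined
      below.\<close>
    let ?p = "\<lambda>\<psi>. [:a \<psi>, 2 * Re (cnj (cip \<phi> \<psi>) * (cnj z * \<psi> $ j)), (cmod (\<psi> $ j))\<^sup>2:]"
    let ?q = "[:1, 2 * Re (cnj z * \<phi> $ j), 1:]"
    have "(\<integral>\<psi>. coeff (?p \<psi> ^ k) 2 \<partial>\<mu>) = coeff (smult c (?q ^ k)) 2"
    proof (rule integral_coeff)
      fix \<psi>
      show "degree (?p \<psi> ^ k) \<le> 2 * k"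
        by (rule order_trans[OF degree_power_le]) simp
    next
      fix n
      have "continuous_on UNIV (\<lambda>\<psi>. coeff (?p \<psi>) n)" for n
        by (intro continuous_on_coeff_pCons continuous_intros cont_a)
      then show "integrable \<mu> (\<lambda>\<psi>. coeff (?p \<psi> ^ k) n)"
        by (intro int continuous_on_coeff_power)
    next
      fix t
      define v where "v = \<phi> + (of_real t * z) *s axis j 1"
      have "cip v \<psi> = cip \<phi> \<psi> + of_real t * (cnj z * \<psi> $ j)" for \<psi>
        by (simp add: v_def cip_add_left cip_scale_left cip_axis_left)
      then have 1: "(cmod (cip v \<psi>))\<^sup>2 = poly (?p \<psi>) t" for \<psi>
        by (simp only: poly_quadratic norm_add_scaled_sq norm_mult complex_mod_cnj z a_def mult_1)
      have "of_real ((norm v)\<^sup>2) = cip v v" by (simp add: cip_self)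
      also have "\<dots> = of_real 1 + of_real t * (cnj z * \<phi> $ j + cnj (cnj z * \<phi> $ j)) + of_real (t\<^sup>2) * (z * cnj z)"
        unfolding v_def cip_add_left cip_add_right cip_scale_left cip_scale_right
        by (simp add: cip_axis_left cip_axis_right cip_self \<phi> power2_eq_square algebra_simps)
      also have "z * cnj z = 1" using complex_norm_square[of z] z by simp
      also have "cnj z * \<phi> $ j + cnj (cnj z * \<phi> $ j) = of_real (2 * Re (cnj z * \<phi> $ j))"
        by (rule complex_add_cnj)
      also have "of_real 1 + of_real t * \<dots> + of_real (t\<^sup>2) * 1 = of_real (poly ?q t)"
        unfolding poly_quadratic by (simp only: of_real_add of_real_mult mult_1_right of_real_1)
      finally have 2: "(norm v)\<^sup>2 = poly ?q t" by (simp only: of_real_eq_iff)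
      show "(\<integral>\<psi>. poly (?p \<psi> ^ k) t \<partial>\<mu>) = poly (smult c (?q ^ k)) t"
        using c[of v] unfolding 1 2 by simp
    qed
    then show ?thesis by (simp add: coeff_quadratic_power_2)
  qed
  have j: "2 * (real k)\<^sup>2 * (\<integral>\<psi>. a \<psi> ^ m * (cmod (\<psi> $ j))\<^sup>2 \<partial>\<mu>)
      = c * (2 * real k + 2 * real k * (real k - 1) * (cmod (\<phi> $ j))\<^sup>2)" for j
  proof -
    let ?F = "\<lambda>z \<psi>. real k * a \<psi> ^ (k - 1) * (cmod (\<psi> $ j))\<^sup>2
        + real k * (real k - 1) / 2 * a \<psi> ^ (k - 2) * (2 * Re (cnj (cip \<phi> \<psi>) * (cnj z * \<psi> $ j)))\<^sup>2"
    \<comment> \<open>For \<open>z = 1\<close> and \<open>z = \<i>\<close> the real part becomes the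
      real and the imaginary part of \<open>x * y\<close>, so the squares add up to a squared
      modulus.\<close>
    have re: "(2 * Re (x * (cnj 1 * y)))\<^sup>2 + (2 * Re (x * (cnj \<i> * y)))\<^sup>2 = 4 * ((cmod x)\<^sup>2 * (cmod y)\<^sup>2)" for x y
      unfolding cmod_power2 by (simp add: power2_eq_square algebra_simps)
    \<comment> \<open>The coefficients add up to \<open>2 * k + 2 * k * (k - 1) = 2 * k^2\<close>.
      The case \<open>m = 0\<close> is treated apart because \<open>k - 2\<close> truncates there,
      next to the zero factor \<open>k - 1\<close>.\<close>
    have F: "?F 1 \<psi> + ?F \<i> \<psi> = 2 * (real k)\<^sup>2 * (a \<psi> ^ m * (cmod (\<psi> $ j))\<^sup>2)" for \<psi>
    proof -
      have gen: "(x + y * u) + (x + y * v) = 2 * x + y * (u + v)" for x y u v :: real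
        by (simp add: algebra_simps)
      have e: "?F 1 \<psi> + ?F \<i> \<psi> = 2 * (real k * a \<psi> ^ (k - 1) * (cmod (\<psi> $ j))\<^sup>2)
          + real k * (real k - 1) / 2 * a \<psi> ^ (k - 2) * (4 * (a \<psi> * (cmod (\<psi> $ j))\<^sup>2))"
        unfolding gen re complex_mod_cnj a_def ..
      show ?thesis
        unfolding e by (cases m) (simp_all add: k_def power2_eq_square algebra_simps)
    qed
    have "2 * (real k)\<^sup>2 * (\<integral>\<psi>. a \<psi> ^ m * (cmod (\<psi> $ j))\<^sup>2 \<partial>\<mu>) = (\<integral>\<psi>. ?F 1 \<psi> + ?F \<i> \<psi> \<partial>\<mu>)"
      by (simp only: F integral_mult_right_zero)
    also have "\<dots> = (\<integral>\<psi>. ?F 1 \<psi> \<partial>\<mu>) + (\<integral>\<psi>. ?F \<i> \<psi> \<partial>\<mu>)"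
    proof -
      have i: "integrable \<mu> (?F z)" for z
        by (intro int continuous_on_add continuous_on_mult continuous_on_power continuous_on_Re
            continuous_on_norm continuous_on_cnj continuous_on_cip continuous_on_component
            continuous_on_const continuous_on_id cont_a)
      show ?thesis by (rule Bochner_Integration.integral_add[OF i i])
    qed
    also have "\<dots> = c * (2 * real k + real k * (real k - 1) / 2 * (4 * ((cmod 1)\<^sup>2 * (cmod (\<phi> $ j))\<^sup>2)))"
    proof -
      have gen: "c * (x + y * u) + c * (x + y * v) = c * (2 * x + y * (u + v))" for x y u v :: real
        by (simp add: algebra_simps)
      show ?thesis
        unfolding coef[OF norm_one] coef[OF norm_ii] gen re[of 1 "\<phi> $ j", unfolded mult_1] ..
    qed
    also have "\<dots> = c * (2 * real k + 2 * real k * (real k - 1) * (cmod (\<phi> $ j))\<^sup>2)"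
      by simp
    finally show ?thesis .
  qed
  \<comment> \<open>Summation over \<open>j\<close> uses that \<open>\<psi>\<close> has norm 1 on
    the space of \<open>\<mu>\<close>, and further below that \<open>\<phi>\<close> has norm
    1.\<close>
  have "2 * (real k)\<^sup>2 * (\<integral>\<psi>. a \<psi> ^ m \<partial>\<mu>) = 2 * (real k)\<^sup>2 * (\<integral>\<psi>. (\<Sum>j\<in>UNIV. a \<psi> ^ m * (cmod (\<psi> $ j))\<^sup>2) \<partial>\<mu>)"
  proof -
    have "(\<Sum>j\<in>UNIV. a \<psi> ^ m * (cmod (\<psi> $ j))\<^sup>2) = a \<psi> ^ m" if "\<psi> \<in> space \<mu>" for \<psi>
      using that unfolding sum_distrib_left[symmetric] norm_sq_eq_sum[symmetric]
      by (simp add: space_invariant[OF \<mu>])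
    then have "(\<integral>\<psi>. (\<Sum>j\<in>UNIV. a \<psi> ^ m * (cmod (\<psi> $ j))\<^sup>2) \<partial>\<mu>) = (\<integral>\<psi>. a \<psi> ^ m \<partial>\<mu>)"
      by (intro Bochner_Integration.integral_cong refl)
    then show ?thesis by simp
  qed
  also have "\<dots> = (\<Sum>j\<in>UNIV. 2 * (real k)\<^sup>2 * (\<integral>\<psi>. a \<psi> ^ m * (cmod (\<psi> $ j))\<^sup>2 \<partial>\<mu>))"
    using cont_a by (subst Bochner_Integration.integral_sum) (auto intro!: int continuous_intros simp: sum_distrib_left)
  also have "\<dots> = c * (2 * real k * real CARD('n) + 2 * real k * (real k - 1) * (\<Sum>j\<in>UNIV. (cmod (\<phi> $ j))\<^sup>2))"
    unfolding j sum_distrib_left[symmetric] sum.distrib by simp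
  also have "\<dots> = 2 * real k * (c * (real CARD('n) + real m))"
    unfolding norm_sq_eq_sum[symmetric] by (simp add: \<phi> k_def algebra_simps)
  finally have "2 * real k * (real k * (\<integral>\<psi>. a \<psi> ^ m \<partial>\<mu>)) = 2 * real k * (c * (real CARD('n) + real m))"
    by (simp only: power2_eq_square mult.assoc)
  then have "real k * (\<integral>\<psi>. a \<psi> ^ m \<partial>\<mu>) = c * (real CARD('n) + real m)"
    by (simp add: k_def)
  then show ?thesis unfolding ck a_def k_def by (simp add: mult.commute)
qed

section \<open>Polynomial expectations of the overlap\<close>

lemma overlap_le_1: "norm u = 1 \<Longrightarrow> norm v = 1 \<Longrightarrow> (cmod (cip u v))\<^sup>2 \<le> 1"
  using Cauchy_Schwarz_cip[of u v] by (simp add: power_le_one)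

text \<open>Both sides are additive in \<open>p\<close>, so monomials suffice. A constant gives 0 on
  both sides, and for degree \<open>m + 1\<close> the identity is \<open>moment_recurrence\<close>
  rearranged.\<close>

lemma integral_pderiv_overlap:
  fixes \<phi> :: "complex^'n"
  assumes \<mu>: "unitarily_invariant_prob \<mu>" and \<phi>: "norm \<phi> = 1"
  defines "q \<equiv> \<lambda>\<psi>. (cmod (cip \<phi> \<psi>))\<^sup>2"
  shows "(\<integral>\<psi>. poly (pderiv p) (q \<psi>) * (1 - q \<psi>) \<partial>\<mu>)
       = (real CARD('n) - 1) * (\<integral>\<psi>. poly p (q \<psi>) - poly p 0 \<partial>\<mu>)"
proof -
  have cont: "continuous_on UNIV q" unfolding q_def by (intro continuous_intros)
  have int: "integrable \<mu> f" if "continuous_on UNIV f" for f :: "complex^'n \<Rightarrow> real"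
    using \<mu> that by (rule integrable_invariant)
  have cp: "continuous_on UNIV (\<lambda>\<psi>. poly p (q \<psi>))" for p
    using continuous_on_compose2[OF continuous_on_poly[OF continuous_on_id, of UNIV] cont] by auto
  let ?P = "\<lambda>p. (\<integral>\<psi>. poly (pderiv p) (q \<psi>) * (1 - q \<psi>) \<partial>\<mu>)
       = (real CARD('n) - 1) * (\<integral>\<psi>. poly p (q \<psi>) - poly p 0 \<partial>\<mu>)"
  have add: "?P (p + r)" if p: "?P p" and r: "?P r" for p r
  proof -
    have "(\<integral>\<psi>. poly (pderiv (p + r)) (q \<psi>) * (1 - q \<psi>) \<partial>\<mu>)
        = (\<integral>\<psi>. poly (pderiv p) (q \<psi>) * (1 - q \<psi>) + poly (pderiv r) (q \<psi>) * (1 - q \<psi>) \<partial>\<mu>)"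
      by (simp add: pderiv_add distrib_right)
    also have "\<dots> = (\<integral>\<psi>. poly (pderiv p) (q \<psi>) * (1 - q \<psi>) \<partial>\<mu>) + (\<integral>\<psi>. poly (pderiv r) (q \<psi>) * (1 - q \<psi>) \<partial>\<mu>)"
      by (intro Bochner_Integration.integral_add int continuous_intros cp cont)
    also have "\<dots> = (real CARD('n) - 1) * ((\<integral>\<psi>. poly p (q \<psi>) - poly p 0 \<partial>\<mu>) + (\<integral>\<psi>. poly r (q \<psi>) - poly r 0 \<partial>\<mu>))"
      unfolding p r by (simp add: algebra_simps)
    also have "(\<integral>\<psi>. poly p (q \<psi>) - poly p 0 \<partial>\<mu>) + (\<integral>\<psi>. poly r (q \<psi>) - poly r 0 \<partial>\<mu>)
        = (\<integral>\<psi>. (poly p (q \<psi>) - poly p 0) + (poly r (q \<psi>) - poly r 0) \<partial>\<mu>)"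
      by (intro Bochner_Integration.integral_add[symmetric] int continuous_intros cp)
    finally show ?thesis by (simp add: algebra_simps)
  qed
  have mono: "?P (monom c n)" for c n
  proof (cases n)
    case 0
    then show ?thesis by (simp add: pderiv_monom poly_monom)
  next
    case (Suc m)
    have "(\<integral>\<psi>. poly (pderiv (monom c n)) (q \<psi>) * (1 - q \<psi>) \<partial>\<mu>)
        = (\<integral>\<psi>. c * (real (Suc m) * q \<psi> ^ m) - c * (real (Suc m) * q \<psi> ^ Suc m) \<partial>\<mu>)"
      unfolding Suc by (simp add: pderiv_monom poly_monom algebra_simps del: of_nat_Suc)
    also have "\<dots> = (\<integral>\<psi>. c * (real (Suc m) * q \<psi> ^ m) \<partial>\<mu>) - (\<integral>\<psi>. c * (real (Suc m) * q \<psi> ^ Suc m) \<partial>\<mu>)"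
      by (intro Bochner_Integration.integral_diff int continuous_intros cont)
    also have "\<dots> = c * (real (Suc m) * (\<integral>\<psi>. q \<psi> ^ m \<partial>\<mu>) - real (Suc m) * (\<integral>\<psi>. q \<psi> ^ Suc m \<partial>\<mu>))"
      by (simp only: integral_mult_right_zero right_diff_distrib)
    also have "real (Suc m) * (\<integral>\<psi>. q \<psi> ^ m \<partial>\<mu>) = (real CARD('n) + real m) * (\<integral>\<psi>. q \<psi> ^ Suc m \<partial>\<mu>)"
      unfolding q_def by (rule moment_recurrence[OF \<mu> \<phi>])
    finally show ?thesis unfolding Suc
      by (simp add: poly_monom algebra_simps del: power_Suc)
  qed
  have "?P (\<Sum>i\<le>n. monom (coeff p i) i)" for n
  proof (induction n)
    case 0
    then show ?case using mono[of "coeff p 0" 0] by simp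
  next
    case (Suc n)
    then show ?case unfolding sum.atMost_Suc by (rule add[OF _ mono])
  qed
  from this[of "degree p"] show ?thesis unfolding poly_as_sum_of_monoms .
qed

text \<open>For \<open>p = (1 - q)^(m + 1)\<close> the derivative times \<open>1 - q\<close> is
  again a multiple of \<open>p\<close>, so \<open>integral_pderiv_overlap\<close> becomes a linear
  equation for the integral \<open>J\<close>.\<close>

lemma integral_power_overlap:
  fixes \<phi> :: "complex^'n"
  assumes \<mu>: "unitarily_invariant_prob \<mu>" and \<phi>: "norm \<phi> = 1"
  shows "(\<integral>\<psi>. (1 - (cmod (cip \<phi> \<psi>))\<^sup>2) ^ Suc m \<partial>\<mu>) = (real CARD('n) - 1) / (real CARD('n) + real m)"
proof -
  let ?q = "\<lambda>\<psi>. (cmod (cip \<phi> \<psi>))\<^sup>2" and ?d = "real CARD('n)"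
  define J where "J = (\<integral>\<psi>. (1 - ?q \<psi>) ^ Suc m \<partial>\<mu>)"
  have "integrable \<mu> (\<lambda>\<psi>. (1 - ?q \<psi>) ^ Suc m)"
    by (intro integrable_invariant[OF \<mu>] continuous_intros)
  moreover have "integrable \<mu> (\<lambda>\<psi>. 1 :: real)"
    by (intro integrable_invariant[OF \<mu>] continuous_intros)
  ultimately have 1: "(\<integral>\<psi>. (1 - ?q \<psi>) ^ Suc m - 1 \<partial>\<mu>) = J - 1"
    unfolding J_def by (simp add: measure_space_invariant[OF \<mu>] del: power_Suc)
  have dp: "poly (pderiv ([:1, -1:] ^ Suc m)) t = - real (Suc m) * (1 - t) ^ m" for t :: real
    unfolding pderiv_power_Suc by (simp add: pderiv_pCons poly_power)
  have "(\<integral>\<psi>. poly (pderiv ([:1, -1:] ^ Suc m)) (?q \<psi>) * (1 - ?q \<psi>) \<partial>\<mu>)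
      = (\<integral>\<psi>. - real (Suc m) * (1 - ?q \<psi>) ^ Suc m \<partial>\<mu>)"
    unfolding dp by (simp add: mult_ac)
  then have "- real (Suc m) * J = (?d - 1) * (J - 1)"
    using integral_pderiv_overlap[OF \<mu> \<phi>, of "[:1, -1:] ^ Suc m"] 1
    unfolding J_def by (simp del: power_Suc of_nat_Suc add: poly_power)
  then have "J * (?d + real m) = ?d - 1" by (simp add: algebra_simps)
  moreover have "0 < ?d + real m" by (simp add: add_pos_nonneg)
  ultimately show ?thesis unfolding J_def[symmetric] by (simp add: field_simps)
qed

text \<open>Writing \<open>q = 1 - (1 - q)\<close> gives a difference of two consecutive values from
  \<open>integral_power_overlap\<close>.\<close>

lemma integral_overlap_mult_power:
  fixes \<phi> :: "complex^'n"
  assumes \<mu>: "unitarily_invariant_prob \<mu>" and \<phi>: "norm \<phi> = 1"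
  defines "q \<equiv> \<lambda>\<psi>. (cmod (cip \<phi> \<psi>))\<^sup>2"
  shows "(\<integral>\<psi>. q \<psi> * (1 - q \<psi>) ^ Suc m \<partial>\<mu>)
       = (real CARD('n) - 1) / ((real CARD('n) + real m) * (real CARD('n) + real m + 1))"
proof -
  let ?d = "real CARD('n)"
  have "(\<integral>\<psi>. q \<psi> * (1 - q \<psi>) ^ Suc m \<partial>\<mu>) = (\<integral>\<psi>. (1 - q \<psi>) ^ Suc m - (1 - q \<psi>) ^ Suc (Suc m) \<partial>\<mu>)"
    by (simp add: algebra_simps)
  also have "\<dots> = (\<integral>\<psi>. (1 - q \<psi>) ^ Suc m \<partial>\<mu>) - (\<integral>\<psi>. (1 - q \<psi>) ^ Suc (Suc m) \<partial>\<mu>)"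
    unfolding q_def by (intro Bochner_Integration.integral_diff integrable_invariant[OF \<mu>] continuous_intros)
  also have "\<dots> = (?d - 1) / (?d + real m) - (?d - 1) / (?d + real (Suc m))"
    unfolding q_def integral_power_overlap[OF \<mu> \<phi>] ..
  also have "\<dots> = (?d - 1) / ((?d + real m) * (?d + real m + 1))"
  proof -
    have "0 < ?d + real m" by (simp add: add_pos_nonneg)
    then show ?thesis by (simp add: divide_simps) (simp add: algebra_simps)
  qed
  finally show ?thesis .
qed

section \<open>Telescoping series and the expectation of \<open>q ln q\<close>\<close>

lemma tendsto_inverse_add: "(\<lambda>m. 1 / (real m + c)) \<longlonglongrightarrow> 0"
proof -
  have "filterlim (\<lambda>m. c + real m) at_top sequentially"
    by (rule filterlim_tendsto_add_at_top[OF tendsto_const filterlim_real_sequentially])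
  then show ?thesis
    by (intro tendsto_divide_0[OF tendsto_const]) (simp add: filterlim_at_top_imp_at_infinity add.commute)
qed

text \<open>Each increment of \<open>d\<close> adds a telescoping series with sum
  \<open>1 / (d + 1)\<close>.\<close>

lemma sums_inverse_diff: "(\<lambda>m. 1 / (real m + 1) - 1 / (real m + 1 + real d)) sums (\<Sum>n=1..d. 1 / real n)"
proof (induction d)
  case (Suc d)
  have "(\<lambda>m. 1 / (real m + 1 + real d)) \<longlonglongrightarrow> 0"
    using tendsto_inverse_add[of "1 + real d"] by (simp add: add_ac)
  from telescope_sums'[OF this]
  have "(\<lambda>m. 1 / (real m + 1 + real d) - 1 / (real (Suc m) + 1 + real d)) sums (1 / (real d + 1))"
    by (simp add: add_ac)
  from sums_add[OF Suc this] show ?case by (simp add: add_ac)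
qed simp

text \<open>Partial fractions split the term into \<open>1 / d\<close> times that of
  \<open>sums_inverse_diff\<close> minus that of a telescoping series with sum \<open>1 / d\<close>;
  the latter removes \<open>n = 1\<close> from the harmonic sum.\<close>

lemma sums_overlap_series:
  assumes "1 \<le> d"
  shows "(\<lambda>m. 1 / (real m + 1) * ((real d - 1) / ((real d + real m) * (real d + real m + 1))))
    sums ((\<Sum>n=2..d. 1 / real n) / real d)"
proof -
  have d: "0 < real d" using assms by simp
  have "(\<lambda>m. 1 / (real m + real d)) \<longlonglongrightarrow> 0"
    by (rule tendsto_inverse_add)
  from telescope_sums'[OF this]
  have T: "(\<lambda>m. 1 / (real m + real d) - 1 / (real (Suc m) + real d)) sums (1 / real d)"
    by simp
  have eq: "1 / real d * (1 / (real m + 1) - 1 / (real m + 1 + real d)) - (1 / (real m + real d) - 1 / (real (Suc m) + real d))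
      = 1 / (real m + 1) * ((real d - 1) / ((real d + real m) * (real d + real m + 1)))" for m
  proof -
    define x where "x = real m"
    have x: "0 \<le> x" by (simp add: x_def)
    have "real (Suc m) = x + 1" by (simp add: x_def)
    then show ?thesis unfolding x_def[symmetric]
      using d x by (simp add: divide_simps add_pos_nonneg) (simp add: algebra_simps)
  qed
  have "1 / real d * (\<Sum>n=1..d. 1 / real n) - 1 / real d = (\<Sum>n=2..d. 1 / real n) / real d"
  proof -
    have h: "(\<Sum>n=1..d. 1 / real n) = 1 + (\<Sum>n=2..d. 1 / real n)"
      using sum.atLeast_Suc_atMost[of 1 d "\<lambda>n. 1 / real n"] assms by (simp add: numeral_2_eq_2)
    show ?thesis unfolding h by (simp add: add_divide_distrib)
  qed
  then show ?thesis
    using sums_diff[OF sums_mult[OF sums_inverse_diff[of d], of "1 / real d"] T] unfolding eq by simp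
qed

text \<open>The logarithmic series at \<open>1 + (q - 1)\<close>, multiplied by \<open>- q\<close>.
  The factor \<open>q\<close> also saves the endpoint \<open>q = 0\<close>, where the logarithmic
  series itself diverges but all terms here vanish.\<close>

lemma sums_mult_ln:
  fixes q :: real
  assumes "0 \<le> q" "q \<le> 1"
  shows "(\<lambda>m. 1 / (real m + 1) * (q * (1 - q) ^ Suc m)) sums (- (q * ln q))"
proof (cases "q = 0")
  case False
  with assms have q: "0 < q" by simp
  have "(\<lambda>n. - ((- (q - 1)) ^ n) / of_nat n) sums ln (1 + (q - 1))"
    using ln_series'[of "q - 1"] assms q by simp
  then have "(\<lambda>n. - ((1 - q) ^ n) / real n) sums ln q" by simp
  then have "(\<lambda>n. - ((1 - q) ^ Suc n) / real (Suc n)) sums ln q"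
    by (subst sums_Suc_iff) simp
  from sums_mult[OF this, of "- q"] show ?thesis by (simp add: add.commute mult_ac)
qed simp

text \<open>The terms of the series are nonnegative on the sphere, so summability of their integrals
  already justifies termwise integration.\<close>

lemma integral_overlap_ln:
  fixes \<phi> :: "complex^'n"
  assumes \<mu>: "unitarily_invariant_prob \<mu>" and \<phi>: "norm \<phi> = 1"
  defines "q \<equiv> \<lambda>\<psi>. (cmod (cip \<phi> \<psi>))\<^sup>2"
  shows "(\<integral>\<psi>. q \<psi> * ln (q \<psi>) \<partial>\<mu>) = - (\<Sum>n=2..CARD('n). 1 / real n) / real CARD('n)"
proof -
  define f where "f m \<psi> = 1 / (real m + 1) * (q \<psi> * (1 - q \<psi>) ^ Suc m)" for m \<psi>
  have q: "0 \<le> q \<psi>" "q \<psi> \<le> 1" if "\<psi> \<in> space \<mu>" for \<psi>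
    using that overlap_le_1[OF \<phi>, of \<psi>] by (simp_all add: q_def space_invariant[OF \<mu>])
  have f0: "0 \<le> f m \<psi>" if "\<psi> \<in> space \<mu>" for m \<psi>
    using q[OF that] by (simp add: f_def)
  have S: "(\<lambda>m. f m \<psi>) sums (- (q \<psi> * ln (q \<psi>)))" if "\<psi> \<in> space \<mu>" for \<psi>
    unfolding f_def using q[OF that] by (rule sums_mult_ln)
  have I: "(\<integral>\<psi>. f m \<psi> \<partial>\<mu>) = 1 / (real m + 1) * ((real CARD('n) - 1) / ((real CARD('n) + real m) * (real CARD('n) + real m + 1)))" for m
    unfolding f_def integral_mult_right_zero q_def integral_overlap_mult_power[OF \<mu> \<phi>] ..
  have sums: "(\<lambda>m. \<integral>\<psi>. f m \<psi> \<partial>\<mu>) sums ((\<Sum>n=2..CARD('n). 1 / real n) / real CARD('n))"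
    unfolding I by (rule sums_overlap_series) (simp add: Suc_leI)
  have "(\<lambda>m. \<integral>\<psi>. f m \<psi> \<partial>\<mu>) sums (\<integral>\<psi>. (\<Sum>m. f m \<psi>) \<partial>\<mu>)"
  proof (rule sums_integral)
    show "integrable \<mu> (f m)" for m
      unfolding f_def q_def by (intro integrable_invariant[OF \<mu>] continuous_intros)
    show "AE \<psi> in \<mu>. summable (\<lambda>m. norm (f m \<psi>))"
      using S f0 by (intro AE_I2) (simp add: sums_iff)
    have "(\<integral>\<psi>. norm (f m \<psi>) \<partial>\<mu>) = (\<integral>\<psi>. f m \<psi> \<partial>\<mu>)" for m
      using f0 by (intro Bochner_Integration.integral_cong) auto
    then show "summable (\<lambda>m. \<integral>\<psi>. norm (f m \<psi>) \<partial>\<mu>)" using sums by (simp add: sums_iff)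
  qed
  then have "(\<integral>\<psi>. (\<Sum>m. f m \<psi>) \<partial>\<mu>) = (\<Sum>n=2..CARD('n). 1 / real n) / real CARD('n)"
    using sums sums_unique2 by blast
  moreover have "(\<integral>\<psi>. (\<Sum>m. f m \<psi>) \<partial>\<mu>) = (\<integral>\<psi>. - (q \<psi> * ln (q \<psi>)) \<partial>\<mu>)"
    using S by (intro Bochner_Integration.integral_cong) (auto simp: sums_iff)
  ultimately show ?thesis by simp
qed

section \<open>Comparison of the two values\<close>

text \<open>Trapezoidal bound for the integral of the convex function \<open>1 / x\<close> over
  \<open>{a..a + 1}\<close>.\<close>

lemma ln_ratio_upper:
  fixes a :: real
  assumes "0 < a"
  shows "ln ((a + 1) / a) \<le> (2 * a + 1) / (2 * a * (a + 1))"
proof -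
  have "ln (a + 1) - ln a \<le> 1 * (inverse a + inverse (a + 1)) / 2"
    using ln_inverse_approx_le[of a 1] assms by (simp add: add.commute mult.commute)
  also have "\<dots> = (2 * a + 1) / (2 * a * (a + 1))"
    using assms by (simp add: field_simps)
  finally show ?thesis using assms by (simp add: ln_div)
qed

text \<open>Midpoint bound for the same integral.\<close>

lemma ln_ratio_lower:
  fixes a :: real
  assumes "0 < a"
  shows "2 / (2 * a + 1) \<le> ln ((a + 1) / a)"
proof -
  have "2 / (2 * a + 1) = inverse ((a + (a + 1)) / 2)"
    using assms by (simp add: field_simps)
  also have "\<dots> \<le> ln (a + 1) - ln a"
    using ln_inverse_approx_ge[of a "a + 1"] assms by simp
  finally show ?thesis using assms by (simp add: ln_div)
qed

text \<open>This is the increment needed in \<open>pretty_good_less_harm\<close>. Its own induction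
  step reduces to an inequality between two consecutive logarithmic ratios \<open>L1\<close> and
  \<open>L2\<close>, settled by the trapezoidal bound for \<open>L1\<close> and the midpoint bound
  for \<open>L2\<close>.\<close>

lemma harm_less_ln:
  assumes "1 \<le> d"
  shows "1 + (\<Sum>n=2..d. 1 / real n) < ln (real d + 1) + real d * ln ((real d + 2) / (real d + 1))"
  using assms
proof (induction d rule: dec_induct)
  case base
  \<comment> \<open>For \<open>d = 1\<close> the sum is empty, and \<open>2 / 3 + 2 / 5\<close>
    exceeds 1.\<close>
  have "2 / 5 \<le> ln (3 / 2 :: real)" using ln_ratio_lower[of 2] by simp
  then show ?case using ln2_ge_two_thirds by simp
next
  case (step d)
  define x where "x = real d"
  define L1 where "L1 = ln ((x + 2) / (x + 1))"
  define L2 where "L2 = ln ((x + 3) / (x + 2))"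
  have x: "1 \<le> x" using step.hyps by (simp add: x_def)
  have "L1 \<le> (2 * x + 3) / (2 * (x + 1) * (x + 2))"
    using ln_ratio_upper[of "x + 1"] x by (simp add: L1_def algebra_simps)
  then have "(x - 1) * L1 + 1 / (x + 1) \<le> (x - 1) * ((2 * x + 3) / (2 * (x + 1) * (x + 2))) + 1 / (x + 1)"
    using x by (intro add_right_mono mult_left_mono) auto
  also have "\<dots> \<le> (x + 1) * (2 / (2 * x + 5))"
  proof -
    have "(x + 1) * (2 / (2 * x + 5)) - ((x - 1) * ((2 * x + 3) / (2 * (x + 1) * (x + 2))) + 1 / (x + 1))
        = 3 / (2 * (x + 2) * (2 * x + 5))"
      using x by (simp add: divide_simps) (simp add: algebra_simps)
    also have "\<dots> \<ge> 0" using x by simp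
    finally show ?thesis by simp
  qed
  also have "\<dots> \<le> (x + 1) * L2"
    using ln_ratio_lower[of "x + 2"] x by (intro mult_left_mono) (auto simp: L2_def algebra_simps)
  finally have *: "(x - 1) * L1 + 1 / (x + 1) \<le> (x + 1) * L2" .
  have "ln (x + 2) = ln (x + 1) + L1" using x by (simp add: L1_def ln_div)
  moreover have "(\<Sum>n=2..Suc d. 1 / real n) = (\<Sum>n=2..d. 1 / real n) + 1 / (x + 1)"
    using step.hyps by (simp add: x_def add.commute)
  moreover have "1 + (\<Sum>n=2..d. 1 / real n) < ln (x + 1) + x * L1"
    using step.IH by (simp add: x_def L1_def)
  ultimately have "1 + (\<Sum>n=2..Suc d. 1 / real n) < ln (x + 2) + (x + 1) * L2"
    using * by (simp add: algebra_simps)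
  then show ?case by (simp add: x_def L2_def add_ac)
qed

text \<open>The comparison of the two values, multiplied by \<open>d * ln 2\<close>. From
  \<open>d\<close> to \<open>d + 1\<close> the left side grows by \<open>S + 1\<close> and the right
  side by the bound in \<open>harm_less_ln\<close>.\<close>

lemma pretty_good_less_harm:
  assumes "2 \<le> d"
  shows "real d * (\<Sum>n=2..d. 1 / real n) < (real d - 1) * ln (real d + 1)"
  using assms
proof (induction d rule: dec_induct)
  case base
  have "ln 3 = ln 2 + ln (3 / 2 :: real)" using ln_div[of 3 "2::real"] by simp
  then show ?case using harm_less_ln[of 1] by simp
next
  case (step d)
  define S where "S = (\<Sum>n=2..d. 1 / real n)"
  have "(\<Sum>n=2..Suc d. 1 / real n) = S + 1 / (real d + 1)"
    using step.hyps by (simp add: S_def add.commute)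
  then have "real (Suc d) * (\<Sum>n=2..Suc d. 1 / real n) = (real d + 1) * S + 1"
    by (simp add: algebra_simps add_divide_distrib[symmetric])
  also have "\<dots> < (real d - 1) * ln (real d + 1) + ln (real d + 1) + real d * ln ((real d + 2) / (real d + 1))"
    using step harm_less_ln[of d] by (simp add: S_def algebra_simps)
  also have "\<dots> = (real (Suc d) - 1) * ln (real (Suc d) + 1)"
    by (simp add: ln_div algebra_simps)
  finally show ?case .
qed

lemma pretty_good_value_less_scrooge_value:
  assumes "2 \<le> d"
  shows "pretty_good_value d < scrooge_value d"
proof -
  have "(\<Sum>n=2..d. 1 / real n) < (real d - 1) / real d * ln (real d + 1)"
    using pretty_good_less_harm[OF assms] assms by (simp add: field_simps)
  then have "(\<Sum>n=2..d. 1 / real n) / ln 2 < (real d - 1) / real d * ln (real d + 1) / ln 2"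
    by (rule divide_strict_right_mono) simp
  then show ?thesis
    by (simp add: pretty_good_value_def scrooge_value_def log_def)
qed

lemma pretty_good_value_le_scrooge_value:
  assumes "1 \<le> d"
  shows "pretty_good_value d \<le> scrooge_value d"
proof (cases "d = 1")
  case False
  then show ?thesis using pretty_good_value_less_scrooge_value[of d] assms by simp
qed (simp add: pretty_good_value_def scrooge_value_def)

section \<open>Mutual information of overlaps\<close>

text \<open>Up to its weight, the contribution of one pair of outcomes: with a maximally mixed
  average state, the joint probability divided by the product of the marginals is \<open>d\<close>
  times the squared overlap.\<close>

definition overlap_info :: "nat \<Rightarrow> complex^'n \<Rightarrow> complex^'n \<Rightarrow> real" where
  "overlap_info d u v = (cmod (cip u v))\<^sup>2 * log 2 (real d * (cmod (cip u v))\<^sup>2)"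

lemma overlap_info_measurable: "overlap_info d u \<in> borel_measurable borel"
proof -
  have [measurable]: "(\<lambda>v. (cmod (cip u v))\<^sup>2) \<in> borel_measurable borel"
    by (intro borel_measurable_continuous_onI continuous_intros)
  show ?thesis unfolding overlap_info_def[abs_def] by measurable
qed

lemma overlap_info_eq:
  assumes "1 \<le> d"
  shows "overlap_info d u v
    = log 2 (real d) * (cmod (cip u v))\<^sup>2 + 1 / ln 2 * ((cmod (cip u v))\<^sup>2 * ln ((cmod (cip u v))\<^sup>2))"
proof (cases "cip u v = 0")
  case False
  then have "log 2 (real d * (cmod (cip u v))\<^sup>2) = log 2 (real d) + log 2 ((cmod (cip u v))\<^sup>2)"
    using assms by (simp add: log_mult)
  then show ?thesis by (simp add: overlap_info_def log_def algebra_simps)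
qed (simp add: overlap_info_def)

text \<open>The lower bound is \<open>ln x \<le> x - 1\<close> at \<open>x = 1 / q\<close>;
  boundedness yields integrability of the overlap logarithm.\<close>

lemma abs_mult_ln_le_1:
  fixes q :: real
  assumes "0 \<le> q" "q \<le> 1"
  shows "\<bar>q * ln q\<bar> \<le> 1"
proof (cases "q = 0")
  case False
  with assms have q: "0 < q" by simp
  have "ln (1 / q) \<le> 1 / q - 1" using q by (intro ln_le_minus_one) simp
  then have "q * ln (1 / q) \<le> q * (1 / q - 1)" using q by (intro mult_left_mono) auto
  then have "- (q * ln q) \<le> 1" using q by (simp add: ln_div algebra_simps)
  moreover have "q * ln q \<le> 0" using q assms by (simp add: mult_nonneg_nonpos)
  ultimately show ?thesis by linarith
qed simp

lemma integrable_overlap_ln: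
  fixes \<phi> :: "complex^'n"
  assumes \<mu>: "unitarily_invariant_prob \<mu>" and \<phi>: "norm \<phi> = 1"
  shows "integrable \<mu> (\<lambda>\<psi>. (cmod (cip \<phi> \<psi>))\<^sup>2 * ln ((cmod (cip \<phi> \<psi>))\<^sup>2))"
proof -
  interpret finite_measure \<mu> using \<mu> by (rule finite_measure_invariant)
  have "AE \<psi> in \<mu>. norm ((cmod (cip \<phi> \<psi>))\<^sup>2 * ln ((cmod (cip \<phi> \<psi>))\<^sup>2)) \<le> 1"
    unfolding real_norm_def
    by (intro AE_I2 abs_mult_ln_le_1 zero_le_power2 overlap_le_1[OF \<phi>]) (simp add: space_invariant[OF \<mu>])
  moreover have [measurable]: "(\<lambda>v. (cmod (cip \<phi> v))\<^sup>2) \<in> borel_measurable borel"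
    by (intro borel_measurable_continuous_onI continuous_intros)
  have "(\<lambda>\<psi>. (cmod (cip \<phi> \<psi>))\<^sup>2 * ln ((cmod (cip \<phi> \<psi>))\<^sup>2)) \<in> borel_measurable \<mu>"
    by (rule borel_measurable_invariant[OF \<mu>]) measurable
  ultimately show ?thesis by (rule integrable_const_bound)
qed

lemma integral_overlap:
  fixes \<phi> :: "complex^'n"
  assumes \<mu>: "unitarily_invariant_prob \<mu>" and \<phi>: "norm \<phi> = 1"
  shows "(\<integral>\<psi>. (cmod (cip \<phi> \<psi>))\<^sup>2 \<partial>\<mu>) = 1 / real CARD('n)"
  using moment_recurrence[OF \<mu> \<phi>, of 0] by (simp add: measure_space_invariant[OF \<mu>] field_simps)

lemma integrable_overlap_info:
  fixes \<phi> :: "complex^'n"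
  assumes \<mu>: "unitarily_invariant_prob \<mu>" and \<phi>: "norm \<phi> = 1" and d: "1 \<le> d"
  shows "integrable \<mu> (overlap_info d \<phi>)"
  unfolding overlap_info_eq[OF d, abs_def]
  by (intro Bochner_Integration.integrable_add integrable_mult_right integrable_overlap_ln[OF \<mu> \<phi>]
      integrable_invariant[OF \<mu>] continuous_intros)

lemma integral_overlap_info:
  fixes \<phi> :: "complex^'n"
  assumes \<mu>: "unitarily_invariant_prob \<mu>" and \<phi>: "norm \<phi> = 1"
  shows "(\<integral>\<psi>. overlap_info CARD('n) \<phi> \<psi> \<partial>\<mu>) = scrooge_value CARD('n) / real CARD('n)"
proof -
  have d: "1 \<le> CARD('n)" by (simp add: Suc_leI)
  let ?q = "\<lambda>\<psi>. (cmod (cip \<phi> \<psi>))\<^sup>2"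
  have "(\<integral>\<psi>. overlap_info CARD('n) \<phi> \<psi> \<partial>\<mu>)
      = (\<integral>\<psi>. log 2 (real CARD('n)) * ?q \<psi> \<partial>\<mu>) + (\<integral>\<psi>. 1 / ln 2 * (?q \<psi> * ln (?q \<psi>)) \<partial>\<mu>)"
    unfolding overlap_info_eq[OF d]
    by (intro Bochner_Integration.integral_add integrable_mult_right integrable_overlap_ln[OF \<mu> \<phi>]
        integrable_invariant[OF \<mu>] continuous_intros)
  also have "\<dots> = scrooge_value CARD('n) / real CARD('n)"
    unfolding integral_mult_right_zero integral_overlap[OF \<mu> \<phi>] integral_overlap_ln[OF \<mu> \<phi>]
    by (simp add: scrooge_value_def diff_divide_distrib)
  finally show ?thesis .
qed

section \<open>The integrand of the mutual information\<close>

lemma info_term: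
  assumes "0 < d" "0 \<le> q" "pp = w / real d"
  shows "(w * q) * log 2 (w * q / pp) = w * (q * log 2 (real d * q))"
\<comment> \<open>\<open>w * q\<close> is the joint probability and \<open>pp\<close> the product of
  the marginals; a nonzero weight \<open>w\<close> cancels inside the logarithm, and for
  \<open>w = 0\<close> both sides are 0.\<close>
proof (cases "w = 0")
  case False
  then have "w * q / pp = real d * q" using assms(1) unfolding assms(3) by (simp add: field_simps)
  then show ?thesis by simp
qed simp

text \<open>The weight \<open>c\<close> may be 0, so zero operators that pad a finite POVM are
  covered.\<close>

lemma mutual_information_integrand_ensemble:
  assumes \<rho>: "\<rho> x = (1 / real d ^ 2) *\<^sub>R ket_bra u" "norm u = 1"
    and P: "P y = c *\<^sub>R ket_bra v" "norm v = 1"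
    and avg: "average_state M \<rho> = (1 / real d) *\<^sub>R mat 1" and d: "0 < d"
  shows "(let pxy = Re (trace (\<rho> x ** P y));
             px = Re (trace (\<rho> x));
             py = Re (trace (average_state M \<rho> ** P y))
         in pxy * log 2 (pxy / (px * py))) = c / real d ^ 2 * overlap_info d u v"
proof -
  have "Re (trace (\<rho> x ** P y)) = c / real d ^ 2 * (cmod (cip u v))\<^sup>2"
    unfolding \<rho> P trace_mult_scaleR_left trace_mult_scaleR_right trace_ket_bra_mult
    by (simp flip: of_real_mult)
  moreover have "Re (trace (\<rho> x)) * Re (trace (average_state M \<rho> ** P y)) = c / real d ^ 2 / real d"
    unfolding avg unfolding \<rho> P trace_mult_scaleR_left trace_mult_scaleR_right trace_scaleR
    by (simp add: trace_scaleR trace_ket_bra \<rho>(2) P(2) flip: of_real_mult)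
  ultimately show ?thesis
    using info_term[OF d, of "(cmod (cip u v))\<^sup>2"] by (simp add: Let_def overlap_info_def)
qed

text \<open>The average state enters only through its trace against \<open>P y\<close>, which for
  the Scrooge ensemble is a first moment of the overlap.\<close>

lemma mutual_information_integrand_povm:
  assumes \<rho>: "\<rho> x = c *\<^sub>R ket_bra v" "norm v = 1"
    and P: "P y = (1 / real d) *\<^sub>R ket_bra u"
    and avg: "trace (average_state M \<rho> ** P y) = of_real (1 / real d ^ 2)" and d: "0 < d"
  shows "(let pxy = Re (trace (\<rho> x ** P y));
             px = Re (trace (\<rho> x));
             py = Re (trace (average_state M \<rho> ** P y))
         in pxy * log 2 (pxy / (px * py))) = c / real d * overlap_info d u v"
proof -
  have "Re (trace (\<rho> x ** P y)) = c / real d * (cmod (cip u v))\<^sup>2"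
    unfolding \<rho> P trace_mult_scaleR_left trace_mult_scaleR_right trace_ket_bra_mult norm_cip_commute[of u v]
    by (simp flip: of_real_mult)
  moreover have "Re (trace (\<rho> x)) * Re (trace (average_state M \<rho> ** P y)) = c / real d / real d"
    unfolding avg by (simp add: \<rho> trace_scaleR trace_ket_bra power2_eq_square del: of_real_power flip: of_real_mult)
  ultimately show ?thesis
    using info_term[OF d, of "(cmod (cip u v))\<^sup>2"] by (simp add: Let_def overlap_info_def)
qed

section \<open>Integrals with a discrete index\<close>

lemma integral_pair_count_space:
  fixes f :: "'a \<times> 'b \<Rightarrow> real"
  assumes "countable A" "countable B" "finite S" "S \<subseteq> A \<times> B" "\<And>p. p \<in> A \<times> B - S \<Longrightarrow> f p = 0"
  shows "(\<integral>p. f p \<partial>(count_space A \<Otimes>\<^sub>M count_space B)) = (\<Sum>p\<in>S. f p)"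
proof -
  have S: "{p \<in> A \<times> B. f p \<noteq> 0} \<subseteq> S" using assms(5) by blast
  have "(\<integral>p. f p \<partial>(count_space A \<Otimes>\<^sub>M count_space B)) = (\<Sum>p | p \<in> A \<times> B \<and> f p \<noteq> 0. f p)"
    unfolding pair_measure_countable[OF assms(1,2)]
    by (rule lebesgue_integral_count_space_finite_support) (rule finite_subset[OF S assms(3)])
  also have "\<dots> = (\<Sum>p\<in>S. f p)"
    using assms(3,4) by (intro sum.mono_neutral_left S) auto
  finally show ?thesis .
qed

lemma (in finite_measure) finite_count_space_pair:
  assumes "finite I"
  shows "pair_sigma_finite (count_space I) M"
  using assms by (intro pair_sigma_finite.intro sigma_finite_measure_count_space_finite sigma_finite_measure_axioms)

text \<open>Both orders occur: the SIC index comes first against the Scrooge POVM and second against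
  the Scrooge ensemble.\<close>

lemma (in finite_measure) integral_finite_pair:
  fixes f :: "'i::countable \<Rightarrow> 'a \<Rightarrow> real"
  assumes I: "finite I" and int: "\<And>x. x \<in> I \<Longrightarrow> integrable M (f x)"
  shows "(\<integral>p. f (fst p) (snd p) \<partial>(count_space I \<Otimes>\<^sub>M M)) = (\<Sum>x\<in>I. \<integral>y. f x y \<partial>M)" (is ?fst)
    and "(\<integral>p. f (snd p) (fst p) \<partial>(M \<Otimes>\<^sub>M count_space I)) = (\<Sum>x\<in>I. \<integral>y. f x y \<partial>M)" (is ?snd)
proof -
  interpret pair_sigma_finite "count_space I" M by (rule finite_count_space_pair[OF I])
  have m: "(\<lambda>p. f (fst p) (snd p)) \<in> borel_measurable (count_space I \<Otimes>\<^sub>M M)"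
    using int by (intro measurable_pair_measure_countable1) (auto simp: countable_finite[OF I])
  have "integrable (count_space I \<Otimes>\<^sub>M M) (\<lambda>p. f (fst p) (snd p))"
    using int by (intro Fubini_integrable[OF m]) (auto simp: integrable_count_space[OF I] intro!: AE_I2)
  from integral_fst'[OF this] show ?fst
    by (simp add: lebesgue_integral_count_space_finite[OF I])
  then show ?snd using integral_product_swap[OF m] by (simp add: case_prod_unfold)
qed

text \<open>Serves finite families padded with zeros to the index type \<open>nat\<close>, over
  which the discrete suprema range.\<close>

lemma has_bochner_integral_count_space_nat_finite:
  fixes f :: "nat \<Rightarrow> 'b::{banach, second_countable_topology}"
  assumes "\<And>k. N \<le> k \<Longrightarrow> f k = 0"
  shows "has_bochner_integral (count_space UNIV) f (\<Sum>k<N. f k)"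
  unfolding has_bochner_integral_iff
proof
  show "integrable (count_space UNIV) f"
    unfolding integrable_count_space_nat_iff
    by (rule summable_finite[of "{..<N}"]) (use assms in \<open>auto simp: not_less\<close>)
  have "{k. f k \<noteq> 0} \<subseteq> {..<N}" using assms not_less by blast
  then show "integral\<^sup>L (count_space UNIV) f = (\<Sum>k<N. f k)"
    by (subst lebesgue_integral_count_space_finite_support)
      (auto intro!: sum.mono_neutral_left intro: finite_subset)
qed

section \<open>Mutual information of SIC ensembles and POVMs\<close>

text \<open>Each row has one diagonal term \<open>log 2 d\<close> and \<open>d^2 - 1\<close> equal
  terms with overlap \<open>1 / (d + 1)\<close>, whose total weight is \<open>d - 1\<close>.\<close>

lemma sum_overlap_info_sic:
  fixes \<phi> :: "nat \<Rightarrow> complex^'n"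
  assumes 1: "\<And>x. x \<in> {1..d^2} \<Longrightarrow> norm (\<phi> x) = 1"
    and 2: "\<And>x y. x \<in> {1..d^2} \<Longrightarrow> y \<in> {1..d^2} \<Longrightarrow> x \<noteq> y \<Longrightarrow> (cmod (cip (\<phi> x) (\<phi> y)))\<^sup>2 = 1 / (real d + 1)"
    and d: "1 \<le> d"
  shows "(\<Sum>x\<in>{1..d^2}. \<Sum>y\<in>{1..d^2}. overlap_info d (\<phi> x) (\<phi> y)) = real d ^ 3 * pretty_good_value d"
proof -
  have "(\<Sum>y\<in>{1..d^2}. overlap_info d (\<phi> x) (\<phi> y)) = real d * pretty_good_value d" if x: "x \<in> {1..d^2}" for x
  proof -
    have "(\<Sum>y\<in>{1..d^2}. overlap_info d (\<phi> x) (\<phi> y))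
        = overlap_info d (\<phi> x) (\<phi> x) + (\<Sum>y\<in>{1..d^2} - {x}. overlap_info d (\<phi> x) (\<phi> y))"
      using x by (simp add: sum.remove)
    also have "overlap_info d (\<phi> x) (\<phi> x) = log 2 (real d)"
      using 1[OF x] by (simp add: overlap_info_def cip_self)
    also have "(\<Sum>y\<in>{1..d^2} - {x}. overlap_info d (\<phi> x) (\<phi> y))
        = (\<Sum>y\<in>{1..d^2} - {x}. 1 / (real d + 1) * log 2 (real d / (real d + 1)))"
      using x by (intro sum.cong refl) (simp add: overlap_info_def 2 del: One_nat_def)
    also have "\<dots> = (real d ^ 2 - 1) / (real d + 1) * log 2 (real d / (real d + 1))"
      using x d by (simp add: of_nat_diff)
    also have "(real d ^ 2 - 1) / (real d + 1) = real d - 1"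
      by (simp add: field_simps power2_eq_square)
    also have "log 2 (real d / (real d + 1)) = log 2 (real d) - log 2 (real d + 1)"
      using d by (simp add: log_divide)
    also have "log 2 (real d) + (real d - 1) * (log 2 (real d) - log 2 (real d + 1)) = real d * pretty_good_value d"
      using d by (simp add: pretty_good_value_def field_simps)
    finally show ?thesis .
  qed
  then show ?thesis by (simp add: power2_eq_square power3_eq_cube)
qed

text \<open>By invariance every \<open>F (V k *v \<psi>)\<close> has the same integral as
  \<open>F\<close>, and so has their average over \<open>k\<close>; on a probability space a
  function cannot lie strictly below its mean everywhere.\<close>

lemma ex_unitary_average_ge_integral:
  fixes \<mu> :: "(complex^'n) measure" and V :: "nat \<Rightarrow> complex^'n^'n"
  assumes \<mu>: "unitarily_invariant_prob \<mu>" and V: "\<And>k. unitary (V k)"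
    and F: "F \<in> borel_measurable borel" "integrable \<mu> F" and N: "0 < N"
  shows "\<exists>\<psi>. norm \<psi> = 1 \<and> (\<integral>\<psi>. F \<psi> \<partial>\<mu>) \<le> (\<Sum>k<N. F (V k *v \<psi>)) / real N"
proof (rule ccontr)
  interpret finite_measure \<mu> using \<mu> by (rule finite_measure_invariant)
  assume "\<not> ?thesis"
  then have less: "(\<Sum>k<N. F (V k *v \<psi>)) / real N < (\<integral>\<psi>. F \<psi> \<partial>\<mu>)" if "\<psi> \<in> space \<mu>" for \<psi>
    using that by (auto simp: space_invariant[OF \<mu>] not_le)
  have int: "integrable \<mu> (\<lambda>\<psi>. F (V k *v \<psi>))" for k
  proof -
    have "distr \<mu> \<mu> ((*v) (V k)) = \<mu>" using \<mu> V by (simp add: unitarily_invariant_prob_def)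
    then show ?thesis
      by (intro integrable_distr[OF measurable_unitary[OF \<mu> V]]) (simp add: F(2))
  qed
  have "(\<integral>\<psi>. (\<Sum>k<N. F (V k *v \<psi>)) / real N \<partial>\<mu>) = (\<Sum>k<N. \<integral>\<psi>. F (V k *v \<psi>) \<partial>\<mu>) / real N"
    using int by simp
  also have "\<dots> = (\<integral>\<psi>. F \<psi> \<partial>\<mu>)"
    using N by (simp add: integral_unitary[OF \<mu> F(1) V])
  finally have eq: "(\<integral>\<psi>. (\<Sum>k<N. F (V k *v \<psi>)) / real N \<partial>\<mu>) = (\<integral>\<psi>. (\<integral>\<psi>. F \<psi> \<partial>\<mu>) \<partial>\<mu>)"
    by (simp add: measure_space_invariant[OF \<mu>])
  have "(\<integral>\<psi>. (\<Sum>k<N. F (V k *v \<psi>)) / real N \<partial>\<mu>) < (\<integral>\<psi>. (\<integral>\<psi>. F \<psi> \<partial>\<mu>) \<partial>\<mu>)"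
    using int less \<mu> by (intro integral_less_AE_space AE_I2) (auto simp: unitarily_invariant_prob_def)
  then show False using eq by simp
qed

text \<open>The averaging argument for the Weyl--Heisenberg operators: the bound comes from the mean
  over \<open>\<psi>\<close>, the resolution of the identity holds for every
  \<open>\<psi>\<close>.\<close>

lemma ex_Weyl_Heisenberg_orbit_ge_scrooge_value:
  fixes \<phi> :: "nat \<Rightarrow> complex^'n" and \<mu> :: "(complex^'n) measure"
  assumes \<mu>: "unitarily_invariant_prob \<mu>" and d: "d = CARD('n)"
    and \<phi>: "\<And>x. x \<in> {1..d^2} \<Longrightarrow> norm (\<phi> x) = 1"
  obtains v :: "nat \<Rightarrow> complex^'n" where "\<And>k. norm (v k) = 1"
    and "(\<Sum>k<d^2. ket_bra (v k)) = real d *\<^sub>R mat 1"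
    and "scrooge_value d \<le> (\<Sum>x\<in>{1..d^2}. \<Sum>k<d^2. 1 / real d ^ 3 * overlap_info d (\<phi> x) (v k))"
proof -
  have d1: "1 \<le> d" by (simp add: d Suc_leI)
  obtain V :: "nat \<Rightarrow> complex^'n^'n" where V: "\<And>k. unitary (V k)"
    "\<And>v. (\<Sum>k<CARD('n)^2. ket_bra (V k *v v)) = (real CARD('n) * (norm v)\<^sup>2) *\<^sub>R mat 1"
    using ex_Weyl_Heisenberg[where 'n = 'n] by blast
  \<comment> \<open>The factor \<open>1 / d\<close> makes the integral
    \<open>d^2 * (1 / d) * (scrooge_value d / d)\<close>; the average over \<open>d^2\<close> orbit
    points then supplies the remaining part of the joint weight \<open>1 / d^3\<close>.\<close>
  define F where "F \<psi> = (\<Sum>x\<in>{1..d^2}. 1 / real d * overlap_info d (\<phi> x) \<psi>)" for \<psi>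
  have int: "integrable \<mu> (\<lambda>\<psi>. 1 / real d * overlap_info d (\<phi> x) \<psi>)" if "x \<in> {1..d^2}" for x
    using that d1 by (intro integrable_mult_right integrable_overlap_info[OF \<mu> \<phi>])
  have Fm: "F \<in> borel_measurable borel"
    unfolding F_def[abs_def]
    by (intro borel_measurable_sum borel_measurable_times borel_measurable_const overlap_info_measurable)
  have Fi: "integrable \<mu> F"
    unfolding F_def[abs_def] by (intro Bochner_Integration.integrable_sum int)
  have IF: "(\<integral>\<psi>. F \<psi> \<partial>\<mu>) = scrooge_value d"
  proof -
    have "(\<integral>\<psi>. F \<psi> \<partial>\<mu>) = (\<Sum>x\<in>{1..d^2}. \<integral>\<psi>. 1 / real d * overlap_info d (\<phi> x) \<psi> \<partial>\<mu>)"
      unfolding F_def by (rule Bochner_Integration.integral_sum[OF int])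
    also have "\<dots> = (\<Sum>x\<in>{1..d^2}. 1 / real d * (scrooge_value d / real d))"
      using \<phi> by (intro sum.cong refl) (simp only: integral_mult_right_zero d integral_overlap_info[OF \<mu>])
    also have "\<dots> = scrooge_value d" using d1 by (simp add: power2_eq_square)
    finally show ?thesis .
  qed
  have "0 < d^2" using d1 by simp
  from ex_unitary_average_ge_integral[where V = V, OF \<mu> V(1) Fm Fi this]
  obtain \<psi> where \<psi>: "norm \<psi> = 1" "(\<integral>\<psi>. F \<psi> \<partial>\<mu>) \<le> (\<Sum>k<d^2. F (V k *v \<psi>)) / real (d^2)"
    by (elim exE conjE)
  show thesis
  proof
    show "norm (V k *v \<psi>) = 1" for k by (simp add: norm_unitary[OF V(1)] \<psi>(1))
    show "(\<Sum>k<d^2. ket_bra (V k *v \<psi>)) = real d *\<^sub>R mat 1" by (simp add: d V(2) \<psi>(1))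
    have "(\<Sum>k<d^2. F (V k *v \<psi>)) / real (d^2)
        = (\<Sum>k<d^2. \<Sum>x\<in>{1..d^2}. 1 / real d ^ 3 * overlap_info d (\<phi> x) (V k *v \<psi>))"
      unfolding F_def sum_divide_distrib by (simp add: power2_eq_square power3_eq_cube mult.assoc)
    also have "\<dots> = (\<Sum>x\<in>{1..d^2}. \<Sum>k<d^2. 1 / real d ^ 3 * overlap_info d (\<phi> x) (V k *v \<psi>))"
      by (rule sum.swap)
    finally show "scrooge_value d \<le> (\<Sum>x\<in>{1..d^2}. \<Sum>k<d^2. 1 / real d ^ 3 * overlap_info d (\<phi> x) (V k *v \<psi>))"
      using \<psi>(2) IF by simp
  qed
qed

lemma sic_overlap:
  fixes X :: "nat \<Rightarrow> complex^'n^'n"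
  assumes "sic_set X t" "0 < t" "d = CARD('n)"
    and X: "\<And>x. x \<in> {1..d^2} \<Longrightarrow> X x = t *\<^sub>R ket_bra (\<phi> x)"
    and xy: "x \<in> {1..d^2}" "y \<in> {1..d^2}" "x \<noteq> y"
  shows "(cmod (cip (\<phi> x) (\<phi> y)))\<^sup>2 = 1 / (real d + 1)"
proof -
  have "trace (X x ** X y) = of_real (t\<^sup>2 / (real d + 1))"
    using assms(1) xy unfolding sic_set_def assms(3) by blast
  then have "complex_of_real (t * (t * (cmod (cip (\<phi> x) (\<phi> y)))\<^sup>2)) = of_real (t\<^sup>2 / (real d + 1))"
    unfolding X[OF xy(1)] X[OF xy(2)] trace_mult_scaleR_left trace_mult_scaleR_right trace_ket_bra_mult
    by (simp only: of_real_mult)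
  then have "t\<^sup>2 * (cmod (cip (\<phi> x) (\<phi> y)))\<^sup>2 = t\<^sup>2 * (1 / (real d + 1))"
    by (simp only: of_real_eq_iff) (simp add: power2_eq_square)
  then show ?thesis unfolding mult_left_cancel[OF power_not_zero[OF less_imp_neq[OF assms(2), symmetric]]] .
qed

section \<open>Average states and pretty-good constructions\<close>

lemma average_state_finite:
  "finite I \<Longrightarrow> average_state (count_space I) \<rho> = (\<Sum>x\<in>I. \<rho> x)"
  by (simp add: average_state_def lebesgue_integral_count_space_finite)

text \<open>The trace against \<open>P\<close> is a bounded linear functional and passes under the
  integral, leaving the first moment of the overlap.\<close>

lemma trace_average_state_scrooge:
  fixes P :: "complex^'n^'n"
  assumes \<mu>: "unitarily_invariant_prob \<mu>" and P: "P = c *\<^sub>R ket_bra u" "norm u = 1"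
  shows "trace (average_state \<mu> scrooge_ensemble ** P) = of_real (c / real CARD('n))"
proof -
  have kb: "integrable \<mu> (ket_bra :: complex^'n \<Rightarrow> _)"
    unfolding ket_bra_def[abs_def] by (intro integrable_invariant[OF \<mu>] continuous_intros)
  have "linear (\<lambda>A :: complex^'n^'n. trace (A ** P))"
    by (rule linearI) (simp_all add: trace_mult distrib_right sum.distrib scaleR_sum_right)
  then have bl: "bounded_linear (\<lambda>A :: complex^'n^'n. trace (A ** P))"
    by (simp add: linear_conv_bounded_linear)
  have "trace (average_state \<mu> scrooge_ensemble ** P) = (\<integral>\<psi>. trace (ket_bra \<psi> ** P) \<partial>\<mu>)"
    unfolding average_state_def scrooge_ensemble_def[abs_def]
    by (rule integral_bounded_linear[OF bl kb, symmetric])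
  also have "\<dots> = (\<integral>\<psi>. of_real (c * (cmod (cip u \<psi>))\<^sup>2) \<partial>\<mu>)"
    unfolding P trace_mult_scaleR_right trace_ket_bra_mult norm_cip_commute[of _ u]
    by (simp only: of_real_mult)
  also have "\<dots> = of_real (c / real CARD('n))"
    unfolding integral_complex_of_real integral_mult_right_zero integral_overlap[OF \<mu> P(2)] by simp
  finally show ?thesis .
qed

lemma pretty_good_ensemble_maximally_mixed:
  fixes P :: "nat \<Rightarrow> complex^'n^'n"
  assumes "0 < c"
  shows "pretty_good_ensemble (c *\<^sub>R mat 1) P x = c *\<^sub>R P x"
  using assms by (simp add: pretty_good_ensemble_def psd_sqrt_scalar matrix_scalar_ac
      scalar_matrix_assoc[symmetric])

lemma pretty_good_povm_maximally_mixed: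
  fixes \<rho> :: "nat \<Rightarrow> complex^'n^'n"
  assumes "0 < c" "average_state M \<rho> = (1 / c) *\<^sub>R mat 1"
  shows "pretty_good_povm M \<rho> x = c *\<^sub>R \<rho> x"
proof -
  have "matrix_inv (sqrt (1 / c) *\<^sub>R mat 1 :: complex^'n^'n) = sqrt c *\<^sub>R mat 1"
    using assms(1) by (intro matrix_inv_eqI)
      (simp_all add: matrix_scalar_ac scalar_matrix_assoc[symmetric] real_sqrt_divide)
  then show ?thesis
    using assms by (simp add: pretty_good_povm_def psd_sqrt_scalar matrix_scalar_ac
        scalar_matrix_assoc[symmetric] Let_def)
qed

section \<open>Mutual information of SIC families against discrete and Scrooge families\<close>

lemma mutual_information_ensemble_discrete:
  assumes \<rho>: "\<And>x. x \<in> I \<Longrightarrow> \<rho> x = (1 / real d ^ 2) *\<^sub>R ket_bra (\<phi> x)" "\<And>x. x \<in> I \<Longrightarrow> norm (\<phi> x) = 1"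
    and P: "\<And>y. y \<in> J \<Longrightarrow> P y = c y *\<^sub>R ket_bra (v y)" "\<And>y. y \<in> J \<Longrightarrow> norm (v y) = 1"
    and avg: "average_state (count_space I) \<rho> = (1 / real d) *\<^sub>R mat 1" and d: "0 < d"
    and I: "finite I" and J: "countable J" "finite K" "K \<subseteq> J" "\<And>y. y \<in> J \<Longrightarrow> y \<notin> K \<Longrightarrow> c y = 0"
  shows "mutual_information (count_space I) \<rho> (count_space J) P
    = (\<Sum>x\<in>I. \<Sum>y\<in>K. c y / real d ^ 2 * overlap_info d (\<phi> x) (v y))"
proof -
  have "mutual_information (count_space I) \<rho> (count_space J) P
      = (\<integral>p. c (snd p) / real d ^ 2 * overlap_info d (\<phi> (fst p)) (v (snd p)) \<partial>(count_space I \<Otimes>\<^sub>M count_space J))"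
    unfolding mutual_information_def
    by (intro Bochner_Integration.integral_cong refl, clarsimp simp only: space_pair_measure space_count_space
        mem_Times_iff split_beta fst_conv snd_conv)
      (intro mutual_information_integrand_ensemble \<rho> P avg d)
  \<comment> \<open>\<open>J\<close> may be infinite with zero weights outside \<open>K\<close>;
    only pairs with second index in \<open>K\<close> contribute.\<close>
  also have "\<dots> = (\<Sum>p\<in>I \<times> K. c (snd p) / real d ^ 2 * overlap_info d (\<phi> (fst p)) (v (snd p)))"
    using I J(1-3) by (intro integral_pair_count_space) (auto simp: countable_finite dest: J(4))
  finally show ?thesis by (simp add: sum.cartesian_product case_prod_unfold)
qed

lemma mutual_information_povm_discrete:
  assumes \<rho>: "\<And>x. x \<in> J \<Longrightarrow> \<rho> x = c x *\<^sub>R ket_bra (v x)" "\<And>x. x \<in> J \<Longrightarrow> norm (v x) = 1"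
    and P: "\<And>y. y \<in> I \<Longrightarrow> P y = (1 / real d) *\<^sub>R ket_bra (\<phi> y)" "\<And>y. y \<in> I \<Longrightarrow> norm (\<phi> y) = 1"
    and avg: "average_state (count_space J) \<rho> = (1 / real d) *\<^sub>R mat 1" and d: "0 < d"
    and I: "finite I" and J: "countable J" "finite K" "K \<subseteq> J" "\<And>y. y \<in> J \<Longrightarrow> y \<notin> K \<Longrightarrow> c y = 0"
  shows "mutual_information (count_space J) \<rho> (count_space I) P
    = (\<Sum>y\<in>I. \<Sum>x\<in>K. c x / real d * overlap_info d (\<phi> y) (v x))"
proof -
  have avg': "trace (average_state (count_space J) \<rho> ** P y) = of_real (1 / real d ^ 2)" if "y \<in> I" for y
    unfolding avg P(1)[OF that] trace_mult_scaleR_left trace_mult_scaleR_right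
    by (simp add: trace_ket_bra P(2)[OF that] power2_eq_square)
  have "mutual_information (count_space J) \<rho> (count_space I) P
      = (\<integral>p. c (fst p) / real d * overlap_info d (\<phi> (snd p)) (v (fst p)) \<partial>(count_space J \<Otimes>\<^sub>M count_space I))"
    unfolding mutual_information_def
    by (intro Bochner_Integration.integral_cong refl, clarsimp simp only: space_pair_measure space_count_space
        mem_Times_iff split_beta fst_conv snd_conv)
      (intro mutual_information_integrand_povm \<rho> P avg' d)
  also have "\<dots> = (\<Sum>p\<in>K \<times> I. c (fst p) / real d * overlap_info d (\<phi> (snd p)) (v (fst p)))"
    using I J(1-3) by (intro integral_pair_count_space) (auto simp: countable_finite dest: J(4))
  also have "\<dots> = (\<Sum>x\<in>K. \<Sum>y\<in>I. c x / real d * overlap_info d (\<phi> y) (v x))"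
    by (simp add: sum.cartesian_product case_prod_unfold)
  \<comment> \<open>The SIC index goes outside, the order in which the orbit lemma states its
    bound.\<close>
  also have "\<dots> = (\<Sum>y\<in>I. \<Sum>x\<in>K. c x / real d * overlap_info d (\<phi> y) (v x))"
    by (rule sum.swap)
  finally show ?thesis .
qed

lemma mutual_information_scrooge_povm:
  fixes \<mu> :: "(complex^'n) measure" and \<rho> :: "nat \<Rightarrow> complex^'n^'n"
  assumes \<mu>: "unitarily_invariant_prob \<mu>" and d: "d = CARD('n)"
    and \<rho>: "\<And>x. x \<in> {1..d^2} \<Longrightarrow> \<rho> x = (1 / real d ^ 2) *\<^sub>R ket_bra (\<phi> x)" "\<And>x. x \<in> {1..d^2} \<Longrightarrow> norm (\<phi> x) = 1"
    and avg: "average_state (sic_index d) \<rho> = (1 / real d) *\<^sub>R mat 1"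
  shows "mutual_information (sic_index d) \<rho> \<mu> scrooge_povm = scrooge_value d"
proof -
  interpret finite_measure \<mu> using \<mu> by (rule finite_measure_invariant)
  have d0: "0 < d" by (simp add: d)
  have "mutual_information (sic_index d) \<rho> \<mu> scrooge_povm
      = (\<integral>p. real d / real d ^ 2 * overlap_info d (\<phi> (fst p)) (snd p) \<partial>(sic_index d \<Otimes>\<^sub>M \<mu>))"
    unfolding mutual_information_def
    by (intro Bochner_Integration.integral_cong refl, clarsimp simp only: space_pair_measure space_count_space
        mem_Times_iff split_beta fst_conv snd_conv)
      (intro mutual_information_integrand_ensemble \<rho> avg d0, simp_all add: scrooge_povm_def d space_invariant[OF \<mu>])
  also have "\<dots> = (\<Sum>x\<in>{1..d^2}. \<integral>\<psi>. real d / real d ^ 2 * overlap_info d (\<phi> x) \<psi> \<partial>\<mu>)"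
    using d0 by (intro integral_finite_pair integrable_mult_right integrable_overlap_info[OF \<mu> \<rho>(2)]) auto
  also have "\<dots> = (\<Sum>x\<in>{1..d^2}. real d / real d ^ 2 * (scrooge_value d / real d))"
    using \<rho>(2) by (intro sum.cong refl) (simp only: integral_mult_right_zero d integral_overlap_info[OF \<mu>])
  also have "\<dots> = scrooge_value d" using d0 by (simp add: power2_eq_square)
  finally show ?thesis .
qed

lemma mutual_information_scrooge_ensemble:
  fixes \<mu> :: "(complex^'n) measure" and P :: "nat \<Rightarrow> complex^'n^'n"
  assumes \<mu>: "unitarily_invariant_prob \<mu>" and d: "d = CARD('n)"
    and P: "\<And>x. x \<in> {1..d^2} \<Longrightarrow> P x = (1 / real d) *\<^sub>R ket_bra (\<phi> x)" "\<And>x. x \<in> {1..d^2} \<Longrightarrow> norm (\<phi> x) = 1"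
  shows "mutual_information \<mu> scrooge_ensemble (sic_index d) P = scrooge_value d"
proof -
  interpret finite_measure \<mu> using \<mu> by (rule finite_measure_invariant)
  have d0: "0 < d" by (simp add: d)
  have avg: "trace (average_state \<mu> scrooge_ensemble ** P y) = of_real (1 / real d ^ 2)" if "y \<in> {1..d^2}" for y
    unfolding trace_average_state_scrooge[OF \<mu> P(1)[OF that] P(2)[OF that]] by (simp add: d power2_eq_square)
  have "mutual_information \<mu> scrooge_ensemble (sic_index d) P
      = (\<integral>p. 1 / real d * overlap_info d (\<phi> (snd p)) (fst p) \<partial>(\<mu> \<Otimes>\<^sub>M sic_index d))"
    unfolding mutual_information_def
    by (intro Bochner_Integration.integral_cong refl, clarsimp simp only: space_pair_measure space_count_space
        mem_Times_iff split_beta fst_conv snd_conv)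
      (intro mutual_information_integrand_povm P avg d0, simp_all add: scrooge_ensemble_def space_invariant[OF \<mu>])
  also have "\<dots> = (\<Sum>x\<in>{1..d^2}. \<integral>\<psi>. 1 / real d * overlap_info d (\<phi> x) \<psi> \<partial>\<mu>)"
    using d0 by (intro integral_finite_pair integrable_mult_right integrable_overlap_info[OF \<mu> P(2)]) auto
  also have "\<dots> = (\<Sum>x\<in>{1..d^2}. 1 / real d * (scrooge_value d / real d))"
    using P(2) by (intro sum.cong refl) (simp only: integral_mult_right_zero d integral_overlap_info[OF \<mu>])
  also have "\<dots> = scrooge_value d" using d0 by (simp add: power2_eq_square)
  finally show ?thesis .
qed

text \<open>The Weyl--Heisenberg orbit, weighted and padded with zeros, is one of the discrete POVMs
  in the supremum.\<close>

lemma scrooge_value_le_accessible_information: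
  fixes \<mu> :: "(complex^'n) measure" and \<rho> :: "nat \<Rightarrow> complex^'n^'n"
  assumes \<mu>: "unitarily_invariant_prob \<mu>" and d: "d = CARD('n)"
    and \<rho>: "\<And>x. x \<in> {1..d^2} \<Longrightarrow> \<rho> x = (1 / real d ^ 2) *\<^sub>R ket_bra (\<phi> x)" "\<And>x. x \<in> {1..d^2} \<Longrightarrow> norm (\<phi> x) = 1"
    and avg: "average_state (sic_index d) \<rho> = (1 / real d) *\<^sub>R mat 1"
  shows "ereal (scrooge_value d) \<le> accessible_information (sic_index d) \<rho>"
proof -
  have d0: "0 < d" by (simp add: d)
  obtain v :: "nat \<Rightarrow> complex^'n" where v: "\<And>k. norm (v k) = 1"
    "(\<Sum>k<d^2. ket_bra (v k)) = real d *\<^sub>R mat 1"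
    "scrooge_value d \<le> (\<Sum>x\<in>{1..d^2}. \<Sum>k<d^2. 1 / real d ^ 3 * overlap_info d (\<phi> x) (v k))"
    using ex_Weyl_Heisenberg_orbit_ge_scrooge_value[where \<phi> = \<phi>, OF \<mu> d \<rho>(2)] by blast
  \<comment> \<open>The weight is \<open>1 / d\<close> because the ket-bras of the orbit sum to
    \<open>d\<close> times the identity.\<close>
  define c where "c k = (if k < d^2 then 1 / real d else 0)" for k
  define Q where "Q k = c k *\<^sub>R ket_bra (v k)" for k
  have psdQ: "psd (Q k)" for k by (simp only: Q_def) (intro psd_scale_ket_bra, simp add: c_def)
  have "has_bochner_integral (count_space UNIV) Q (\<Sum>k<d^2. Q k)"
    by (rule has_bochner_integral_count_space_nat_finite) (simp add: Q_def c_def)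
  also have "(\<Sum>k<d^2. Q k) = (1 / real d) *\<^sub>R (\<Sum>k<d^2. ket_bra (v k))"
    by (simp add: Q_def c_def scaleR_sum_right)
  also have "\<dots> = mat 1" using d0 by (simp add: v(2))
  finally have "povm (count_space UNIV) Q"
    by (simp add: povm_def psdQ)
  moreover have "mutual_information (sic_index d) \<rho> (count_space UNIV) Q
      = (\<Sum>x\<in>{1..d^2}. \<Sum>k<d^2. c k / real d ^ 2 * overlap_info d (\<phi> x) (v k))"
    by (intro mutual_information_ensemble_discrete \<rho> Q_def v(1) avg d0) (auto simp: c_def)
  then have "scrooge_value d \<le> mutual_information (sic_index d) \<rho> (count_space UNIV) Q"
    using v(3) by (simp add: c_def power2_eq_square power3_eq_cube mult.assoc)
  ultimately show ?thesis
    unfolding accessible_information_def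
    by (intro Sup_upper2[of "ereal (mutual_information (sic_index d) \<rho> (count_space UNIV) Q)"]) auto
qed

text \<open>The orbit now serves as an ensemble; its average state is maximally mixed because its
  ket-bras sum to a multiple of the identity.\<close>

lemma scrooge_value_le_informational_power:
  fixes \<mu> :: "(complex^'n) measure" and P :: "nat \<Rightarrow> complex^'n^'n"
  assumes \<mu>: "unitarily_invariant_prob \<mu>" and d: "d = CARD('n)"
    and P: "\<And>x. x \<in> {1..d^2} \<Longrightarrow> P x = (1 / real d) *\<^sub>R ket_bra (\<phi> x)" "\<And>x. x \<in> {1..d^2} \<Longrightarrow> norm (\<phi> x) = 1"
  shows "ereal (scrooge_value d) \<le> informational_power (sic_index d) P"
proof -
  have d0: "0 < d" by (simp add: d)
  obtain v :: "nat \<Rightarrow> complex^'n" where v: "\<And>k. norm (v k) = 1"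
    "(\<Sum>k<d^2. ket_bra (v k)) = real d *\<^sub>R mat 1"
    "scrooge_value d \<le> (\<Sum>x\<in>{1..d^2}. \<Sum>k<d^2. 1 / real d ^ 3 * overlap_info d (\<phi> x) (v k))"
    using ex_Weyl_Heisenberg_orbit_ge_scrooge_value[where \<phi> = \<phi>, OF \<mu> d P(2)] by blast
  \<comment> \<open>The weight \<open>1 / d^2\<close> gives the \<open>d^2\<close> unit vectors
    total trace 1.\<close>
  define c where "c k = (if k < d^2 then 1 / real d ^ 2 else 0)" for k
  define Q where "Q k = c k *\<^sub>R ket_bra (v k)" for k
  have psdQ: "psd (Q k)" for k by (simp only: Q_def) (intro psd_scale_ket_bra, simp add: c_def)
  have "has_bochner_integral (count_space UNIV) (\<lambda>k. trace (Q k)) (\<Sum>k<d^2. trace (Q k))"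
    by (rule has_bochner_integral_count_space_nat_finite) (simp add: Q_def c_def trace_def)
  also have "(\<Sum>k<d^2. trace (Q k)) = 1"
    using d0 by (simp add: Q_def c_def trace_scaleR trace_ket_bra v(1))
  finally have "ensemble (count_space UNIV) Q"
    by (simp add: ensemble_def psdQ)
  moreover have "average_state (count_space UNIV) Q = (1 / real d) *\<^sub>R mat 1"
  proof -
    have "has_bochner_integral (count_space UNIV) Q (\<Sum>k<d^2. Q k)"
      by (rule has_bochner_integral_count_space_nat_finite) (simp add: Q_def c_def)
    then have "average_state (count_space UNIV) Q = (\<Sum>k<d^2. Q k)"
      unfolding average_state_def by (rule has_bochner_integral_integral_eq)
    also have "\<dots> = (1 / real d ^ 2) *\<^sub>R (\<Sum>k<d^2. ket_bra (v k))"
      by (simp add: Q_def c_def scaleR_sum_right)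
    finally show ?thesis using d0 unfolding v(2) by (simp add: power2_eq_square)
  qed
  then have "mutual_information (count_space UNIV) Q (sic_index d) P
      = (\<Sum>x\<in>{1..d^2}. \<Sum>k<d^2. c k / real d * overlap_info d (\<phi> x) (v k))"
    by (intro mutual_information_povm_discrete Q_def v(1) P d0) (auto simp: c_def)
  then have "scrooge_value d \<le> mutual_information (count_space UNIV) Q (sic_index d) P"
    using v(3) by (simp add: c_def power2_eq_square power3_eq_cube mult.assoc)
  ultimately show ?thesis
    unfolding informational_power_def
    by (intro Sup_upper2[of "ereal (mutual_information (count_space UNIV) Q (sic_index d) P)"]) auto
qed

section \<open>Combination for a SIC ensemble and a SIC POVM\<close>

theorem mainTheorem3:
  fixes \<rho> P :: "nat \<Rightarrow> complex^'n^'n" and \<mu> :: "(complex^'n) measure" and d :: nat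
  assumes "d = CARD('n)"
    and "sic_ensemble \<rho>"
    and "sic_povm P"
    and "unitarily_invariant_prob \<mu>"
  shows "invertible (average_state (sic_index d) \<rho>) \<and>
         (\<forall>x\<in>{1..d^2}. pretty_good_povm (sic_index d) \<rho> x = real d *\<^sub>R \<rho> x) \<and>
         (\<forall>x\<in>{1..d^2}. pretty_good_ensemble ((1 / real d) *\<^sub>R mat 1) P x = (1 / real d) *\<^sub>R P x) \<and>
         mutual_information (sic_index d) \<rho> (sic_index d) (\<lambda>x. real d *\<^sub>R \<rho> x) = pretty_good_value d \<and>
         mutual_information (sic_index d) (\<lambda>x. (1 / real d) *\<^sub>R P x) (sic_index d) P = pretty_good_value d \<and>
         pretty_good_value d \<le> scrooge_value d \<and>
         ereal (scrooge_value d) \<le> accessible_information (sic_index d) \<rho> \<and>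
         ereal (scrooge_value d) \<le> informational_power (sic_index d) P \<and>
         mutual_information (sic_index d) \<rho> \<mu> scrooge_povm = scrooge_value d \<and>
         mutual_information \<mu> scrooge_ensemble (sic_index d) P = scrooge_value d \<and>
         (2 \<le> d \<longrightarrow>
            mutual_information (sic_index d) \<rho> (sic_index d) (\<lambda>x. real d *\<^sub>R \<rho> x)
              < mutual_information (sic_index d) \<rho> \<mu> scrooge_povm) \<and>
         (2 \<le> d \<longrightarrow>
            mutual_information (sic_index d) (\<lambda>x. (1 / real d) *\<^sub>R P x) (sic_index d) P
              < mutual_information \<mu> scrooge_ensemble (sic_index d) P)"
proof -
  note d = assms(1) and \<mu> = assms(4)
  have d0: "0 < d" by (simp add: d)
  have sic\<rho>: "sic_set \<rho> (1 / real d ^ 2)" and sicP: "sic_set P (1 / real d)"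
    using assms(2,3) by (simp_all add: sic_ensemble_def sic_povm_def d)
  have t: "0 < 1 / real d ^ 2" "0 < 1 / real d" using d0 by simp_all
  obtain \<phi> where \<phi>: "\<And>x. x \<in> {1..d^2} \<Longrightarrow> norm (\<phi> x) = 1"
      "\<And>x. x \<in> {1..d^2} \<Longrightarrow> \<rho> x = (1 / real d ^ 2) *\<^sub>R ket_bra (\<phi> x)"
    using sic_set_ket_bra[OF sic\<rho> t(1)] unfolding d by blast
  obtain \<xi> where \<xi>: "\<And>x. x \<in> {1..d^2} \<Longrightarrow> norm (\<xi> x) = 1"
      "\<And>x. x \<in> {1..d^2} \<Longrightarrow> P x = (1 / real d) *\<^sub>R ket_bra (\<xi> x)"
    using sic_set_ket_bra[OF sicP t(2)] unfolding d by blast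
  \<comment> \<open>The factor \<open>d * t\<close> of \<open>sic_set_sum\<close> is
    \<open>1 / d\<close> for the ensemble and 1 for the POVM.\<close>
  have avg: "average_state (sic_index d) \<rho> = (1 / real d) *\<^sub>R mat 1"
    using sic_set_sum[OF sic\<rho> t(1)] d0 by (simp add: average_state_finite d power2_eq_square)
  have avgP: "average_state (sic_index d) (\<lambda>x. (1 / real d) *\<^sub>R P x) = (1 / real d) *\<^sub>R mat 1"
    using sic_set_sum[OF sicP t(2)] d0 by (simp add: average_state_finite d flip: scaleR_sum_right)
  have "invertible (mat 1 :: complex^'n^'n)" by (simp add: invertible_def)
  then have inv: "invertible (average_state (sic_index d) \<rho>)"
    unfolding avg using d0 by (intro scalar_invertible) auto
  have pg_povm: "pretty_good_povm (sic_index d) \<rho> x = real d *\<^sub>R \<rho> x" for x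
    using d0 by (intro pretty_good_povm_maximally_mixed avg) simp
  have pg_ens: "pretty_good_ensemble ((1 / real d) *\<^sub>R mat 1) P x = (1 / real d) *\<^sub>R P x" for x
    using d0 by (intro pretty_good_ensemble_maximally_mixed) simp
  have mi\<rho>: "mutual_information (sic_index d) \<rho> (sic_index d) (\<lambda>x. real d *\<^sub>R \<rho> x) = pretty_good_value d"
  proof -
    \<comment> \<open>The pretty-good POVM consists of the same ket-bras with weight
      \<open>d / d^2 = 1 / d\<close>, so both indices refer to \<open>\<phi>\<close>.\<close>
    have "mutual_information (sic_index d) \<rho> (sic_index d) (\<lambda>x. real d *\<^sub>R \<rho> x)
        = (\<Sum>x\<in>{1..d^2}. \<Sum>y\<in>{1..d^2}. (1 / real d) / real d ^ 2 * overlap_info d (\<phi> x) (\<phi> y))"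
      using d0 by (intro mutual_information_ensemble_discrete \<phi> avg)
        (auto simp: \<phi>(2) power2_eq_square countable_finite simp del: One_nat_def)
    also have "\<dots> = (1 / real d ^ 3) * (\<Sum>x\<in>{1..d^2}. \<Sum>y\<in>{1..d^2}. overlap_info d (\<phi> x) (\<phi> y))"
      by (simp add: sum_distrib_left power2_eq_square power3_eq_cube mult.assoc)
    also have "(\<Sum>x\<in>{1..d^2}. \<Sum>y\<in>{1..d^2}. overlap_info d (\<phi> x) (\<phi> y)) = real d ^ 3 * pretty_good_value d"
      using d0 by (intro sum_overlap_info_sic \<phi>(1) sic_overlap[OF sic\<rho> t(1) d \<phi>(2)]) auto
    finally show ?thesis using d0 by simp
  qed
  have miP: "mutual_information (sic_index d) (\<lambda>x. (1 / real d) *\<^sub>R P x) (sic_index d) P = pretty_good_value d"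
  proof -
    \<comment> \<open>Likewise the pretty-good ensemble has the ket-bras of \<open>P\<close>, now
      with weight \<open>1 / d^2\<close>.\<close>
    have "mutual_information (sic_index d) (\<lambda>x. (1 / real d) *\<^sub>R P x) (sic_index d) P
        = (\<Sum>x\<in>{1..d^2}. \<Sum>y\<in>{1..d^2}. (1 / real d ^ 2) / real d * overlap_info d (\<xi> x) (\<xi> y))"
      using d0 by (intro mutual_information_povm_discrete \<xi> avgP)
        (auto simp: \<xi>(2) power2_eq_square countable_finite simp del: One_nat_def)
    also have "\<dots> = (1 / real d ^ 3) * (\<Sum>x\<in>{1..d^2}. \<Sum>y\<in>{1..d^2}. overlap_info d (\<xi> x) (\<xi> y))"
      by (simp add: sum_distrib_left power2_eq_square power3_eq_cube mult.assoc)
    also have "(\<Sum>x\<in>{1..d^2}. \<Sum>y\<in>{1..d^2}. overlap_info d (\<xi> x) (\<xi> y)) = real d ^ 3 * pretty_good_value d"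
      using d0 by (intro sum_overlap_info_sic \<xi>(1) sic_overlap[OF sicP t(2) d \<xi>(2)]) auto
    finally show ?thesis using d0 by simp
  qed
  show ?thesis
    using inv pg_povm pg_ens mi\<rho> miP d0 pretty_good_value_le_scrooge_value[of d]
      pretty_good_value_less_scrooge_value[of d]
      scrooge_value_le_accessible_information[OF \<mu> d \<phi>(2,1) avg]
      scrooge_value_le_informational_power[OF \<mu> d \<xi>(2,1)]
      mutual_information_scrooge_povm[OF \<mu> d \<phi>(2,1) avg]
      mutual_information_scrooge_ensemble[OF \<mu> d \<xi>(2,1)]
    by simp
qed

end
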